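(* If a $\mathcal{W}_1$-manifold $(M,P,g)$ admits a natural connection $\nabla'$ (determined by some pair of real parameters $(\lambda,\mu)$) with parallel torsion, then the 1-form $\theta\circ P$ is closed. If moreover $(M,P,g)$ belongs to the class $\overline{\mathcal{W}}_3$ or to the class $\overline{\mathcal{W}}_6$, then the 1-form $\theta$ is closed, too.
   Context: Setting. A Riemannian almost product manifold $(M,P,g)$ is a differentiable manifold $M$ with a $(1,1)$-tensor field $P$ and a Riemannian metric $g$ such that $P^2x=x$ and $g(Px,Py)=g(x,y)$. Throughout $\operatorname{tr}P=0$ and $\dim M=2n$; $x,y,z$ are arbitrary smooth vector fields (or tangent vectors). Let $\nabla$ be the Levi-Civita connection of $g$, $F(x,y,z)=g((\nabla_xP)y,z)$, and $\theta(x)=g^{ij}F(e_i,e_j,x)$, where $\{e_i\}$ is a basis of the tangent space and $(g^{ij})$ is the inverse matrix of $(g(e_i,e_j))$. $(M,P,g)$ is a $\mathcal{W}_1$-manifold if $$F(x,y,z)=\tfrac{1}{2n}\{g(x,y)\theta(z)-g(x,Py)\theta(Pz)+g(x,z)\theta(y)-g(x,Pz)\theta(Py)\}.$$ The vector field $\Omega$ is defined by $g(\Omega,x)=\theta(x)$. Subclasses of $\mathcal{W}_1$. $\overline{\mathcal{W}}_3$: $F(x,y,z)=\frac1{2n}\{[g(x,y)+g(x,Py)]\theta(z)+[g(x,z)+g(x,Pz)]\theta(y)\}$ and $\theta(Px)=-\theta(x)$. $\overline{\mathcal{W}}_6$: $F(x,y,z)=\frac1{2n}\{[g(x,y)-g(x,Py)]\theta(z)+[g(x,z)-g(x,Pz)]\theta(y)\}$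 and $\theta(Px)=\theta(x)$. Natural connections. A linear connection $\nabla'$ is natural if $\nabla'P=\nabla'g=0$. The natural connections considered on a $\mathcal{W}_1$-manifold form a 2-parametric family with parameters $\lambda,\mu\in\mathbb{R}$; the one determined by $(\lambda,\mu)$ is $$\nabla'_xy=\nabla_xy+g(x,Py)\{\lambda P\Omega+\mu\Omega\}-\{\lambda\theta(Py)+\mu\theta(y)\}Px+g(x,y)\{\lambda\Omega+(\mu+\tfrac1{2n})P\Omega\}-\{\lambda\theta(y)+(\mu+\tfrac1{2n})\theta(Py)\}x.$$ Its torsion is $T(x,y)=\nabla'_xy-\nabla'_yx-[x,y]$; the torsion is parallel if $\nabla'T=0$. *)

theory Defs
  imports "HOL-Analysis.Analysis"
begin

section \<open>Smooth maps between Euclidean spaces\<close>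

text \<open>Meant for open \<open>S\<close>.\<close>

primrec Ck_on ::
  "nat \<Rightarrow> 'a::euclidean_space set \<Rightarrow> ('a \<Rightarrow> 'b::real_normed_vector) \<Rightarrow> bool" where
  "Ck_on 0 S f \<longleftrightarrow> continuous_on S f"
| "Ck_on (Suc k) S f \<longleftrightarrow>
     f differentiable_on S \<and> (\<forall>v. Ck_on k S (\<lambda>x. frechet_derivative f (at x) v))"

definition smooth_on :: "'a::euclidean_space set \<Rightarrow> ('a \<Rightarrow> 'b::real_normed_vector) \<Rightarrow> bool" where
  "smooth_on S f \<longleftrightarrow> (\<forall>k. Ck_on k S f)"


section \<open>Smooth manifolds and their tangent spaces\<close>

text \<open>The underlying set of the manifold is the whole type \<open>'m\<close>; its dimension is \<open>CARD('k)\<close>.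
  A chart is given by its domain and its coordinate map.\<close>

type_synonym ('m, 'k) chart = "'m set \<times> ('m \<Rightarrow> real ^ 'k)"

abbreviation dom_of :: "('m, 'k) chart \<Rightarrow> 'm set" where
  "dom_of c \<equiv> fst c"

abbreviation coord :: "('m, 'k) chart \<Rightarrow> 'm \<Rightarrow> real ^ 'k" where
  "coord c \<equiv> snd c"

abbreviation img_of :: "('m, 'k) chart \<Rightarrow> (real ^ 'k) set" where
  "img_of c \<equiv> coord c ` dom_of c"

definition param :: "('m, 'k) chart \<Rightarrow> real ^ 'k \<Rightarrow> 'm" where
  "param c = inv_into (dom_of c) (coord c)"

definition is_chart :: "('m::topological_space, 'k::finite) chart \<Rightarrow> bool" where
  "is_chart c \<longleftrightarrow> open (dom_of c) \<and> open (img_of c) \<and>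
     homeomorphism (dom_of c) (img_of c) (coord c) (param c)"

definition smooth_atlas :: "('m::topological_space, 'k::finite) chart set \<Rightarrow> bool" where
  "smooth_atlas A \<longleftrightarrow>
     (\<forall>c\<in>A. is_chart c) \<and> (\<Union>c\<in>A. dom_of c) = UNIV \<and>
     (\<forall>c\<in>A. \<forall>d\<in>A. smooth_on (coord c ` (dom_of c \<inter> dom_of d)) (coord d \<circ> param c))"

text \<open>Differential of the coordinate change from \<open>c\<close> to \<open>d\<close> at \<open>p\<close>: it turns the components
  of a tangent vector at \<open>p\<close> with respect to \<open>c\<close> into those with respect to \<open>d\<close>.\<close>

definition coord_change ::
  "('m, 'k::finite) chart \<Rightarrow> ('m, 'k) chart \<Rightarrow> 'm \<Rightarrow> real ^ 'k \<Rightarrow> real ^ 'k" where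
  "coord_change c d p = frechet_derivative (coord d \<circ> param c) (at (coord c p))"

text \<open>One chart around each point is selected once and for all, and the tangent space at \<open>p\<close> is
  represented by \<open>real ^ 'k\<close>: the vector \<open>v\<close> stands for the tangent vector at \<open>p\<close> with
  components \<open>v\<close> in the chart \<open>chart_at A p\<close>. In general \<open>chart_at A\<close> is not locally constant in
  \<open>p\<close>, so smoothness of a tensor field has to be expressed through its components
  in every chart \<open>c\<close> of the atlas, obtained by the maps \<open>to_chart A c p\<close> and
  \<open>from_chart A c p\<close>, which are mutually inverse for \<open>p \<in> dom_of c\<close>.\<close>

definition chart_at :: "('m, 'k) chart set \<Rightarrow> 'm \<Rightarrow> ('m, 'k) chart" where
  "chart_at A p = (SOME c. c \<in> A \<and> p \<in> dom_of c)"

definition to_chart ::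
  "('m, 'k::finite) chart set \<Rightarrow> ('m, 'k) chart \<Rightarrow> 'm \<Rightarrow> real ^ 'k \<Rightarrow> real ^ 'k" where
  "to_chart A c p = coord_change (chart_at A p) c p"

definition from_chart ::
  "('m, 'k::finite) chart set \<Rightarrow> ('m, 'k) chart \<Rightarrow> 'm \<Rightarrow> real ^ 'k \<Rightarrow> real ^ 'k" where
  "from_chart A c p = coord_change c (chart_at A p) p"

type_synonym ('m, 'k) field = "'m \<Rightarrow> real ^ 'k"

definition smooth_fun :: "('m, 'k::finite) chart set \<Rightarrow> ('m \<Rightarrow> real) \<Rightarrow> bool" where
  "smooth_fun A f \<longleftrightarrow> (\<forall>c\<in>A. smooth_on (img_of c) (f \<circ> param c))"

definition field_rep ::
  "('m, 'k::finite) chart set \<Rightarrow> ('m, 'k) chart \<Rightarrow> ('m, 'k) field \<Rightarrow> real ^ 'k \<Rightarrow> real ^ 'k" where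
  "field_rep A c X u = (let p = param c u in to_chart A c p (X p))"

definition vector_field :: "('m, 'k::finite) chart set \<Rightarrow> ('m, 'k) field \<Rightarrow> bool" where
  "vector_field A X \<longleftrightarrow> (\<forall>c\<in>A. smooth_on (img_of c) (field_rep A c X))"

definition one_form ::
  "('m, 'k::finite) chart set \<Rightarrow> ('m \<Rightarrow> real ^ 'k \<Rightarrow> real) \<Rightarrow> bool" where
  "one_form A \<alpha> \<longleftrightarrow> (\<forall>p. linear (\<alpha> p)) \<and>
     (\<forall>c\<in>A. \<forall>v. smooth_on (img_of c) (\<lambda>u. let p = param c u in \<alpha> p (from_chart A c p v)))"

definition endomorphism_field ::
  "('m, 'k::finite) chart set \<Rightarrow> ('m \<Rightarrow> real ^ 'k \<Rightarrow> real ^ 'k) \<Rightarrow> bool" where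
  "endomorphism_field A P \<longleftrightarrow> (\<forall>p. linear (P p)) \<and>
     (\<forall>c\<in>A. \<forall>v. smooth_on (img_of c)
        (\<lambda>u. let p = param c u in to_chart A c p (P p (from_chart A c p v))))"

definition riemannian_metric ::
  "('m, 'k::finite) chart set \<Rightarrow> ('m \<Rightarrow> real ^ 'k \<Rightarrow> real ^ 'k \<Rightarrow> real) \<Rightarrow> bool" where
  "riemannian_metric A g \<longleftrightarrow>
     (\<forall>p. bilinear (g p)) \<and>
     (\<forall>p x y. g p x y = g p y x) \<and>
     (\<forall>p x. x \<noteq> 0 \<longrightarrow> g p x x > 0) \<and>
     (\<forall>c\<in>A. \<forall>v w. smooth_on (img_of c)
        (\<lambda>u. let p = param c u in g p (from_chart A c p v) (from_chart A c p w)))"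

text \<open>The derivative \<open>X f\<close> of a function along a vector field.\<close>

definition dir_deriv ::
  "('m, 'k::finite) chart set \<Rightarrow> ('m, 'k) field \<Rightarrow> ('m \<Rightarrow> real) \<Rightarrow> 'm \<Rightarrow> real" where
  "dir_deriv A X f p =
     (let c = chart_at A p in frechet_derivative (f \<circ> param c) (at (coord c p)) (X p))"

text \<open>In coordinates, the \<open>i\<close>-th component of \<open>[X, Y]\<close> is the sum over \<open>j\<close> of
  \<open>X\<^sup>j \<partial>\<^sub>j Y\<^sup>i - Y\<^sup>j \<partial>\<^sub>j X\<^sup>i\<close>, so that \<open>[X, Y] f = X (Y f) - Y (X f)\<close>.\<close>

definition lie_bracket ::
  "('m, 'k::finite) chart set \<Rightarrow> ('m, 'k) field \<Rightarrow> ('m, 'k) field \<Rightarrow> ('m, 'k) field" where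
  "lie_bracket A X Y p =
     (let c = chart_at A p in
        frechet_derivative (field_rep A c Y) (at (coord c p)) (X p)
      - frechet_derivative (field_rep A c X) (at (coord c p)) (Y p))"

definition ext_deriv ::
  "('m, 'k::finite) chart set \<Rightarrow> ('m \<Rightarrow> real ^ 'k \<Rightarrow> real) \<Rightarrow>
   ('m, 'k) field \<Rightarrow> ('m, 'k) field \<Rightarrow> 'm \<Rightarrow> real" where
  "ext_deriv A \<alpha> X Y p =
     dir_deriv A X (\<lambda>q. \<alpha> q (Y q)) p - dir_deriv A Y (\<lambda>q. \<alpha> q (X q)) p
     - \<alpha> p (lie_bracket A X Y p)"

definition closed_one_form ::
  "('m, 'k::finite) chart set \<Rightarrow> ('m \<Rightarrow> real ^ 'k \<Rightarrow> real) \<Rightarrow> bool" where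
  "closed_one_form A \<alpha> \<longleftrightarrow> one_form A \<alpha> \<and>
     (\<forall>X Y p. vector_field A X \<longrightarrow> vector_field A Y \<longrightarrow> ext_deriv A \<alpha> X Y p = 0)"


section \<open>Linear connections\<close>

text \<open>\<open>D X Y\<close> is the covariant derivative of \<open>Y\<close> along \<open>X\<close>. Its value is relevant
  only when \<open>X\<close> and \<open>Y\<close> are smooth vector fields.\<close>

type_synonym ('m, 'k) connection = "('m, 'k) field \<Rightarrow> ('m, 'k) field \<Rightarrow> ('m, 'k) field"

definition linear_connection ::
  "('m, 'k::finite) chart set \<Rightarrow> ('m, 'k) connection \<Rightarrow> bool" where
  "linear_connection A D \<longleftrightarrow>
     (\<forall>X Y. vector_field A X \<longrightarrow> vector_field A Y \<longrightarrow> vector_field A (D X Y)) \<and>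
     (\<forall>X X' Y. vector_field A X \<longrightarrow> vector_field A X' \<longrightarrow> vector_field A Y \<longrightarrow>
        D (\<lambda>p. X p + X' p) Y = (\<lambda>p. D X Y p + D X' Y p)) \<and>
     (\<forall>f X Y. smooth_fun A f \<longrightarrow> vector_field A X \<longrightarrow> vector_field A Y \<longrightarrow>
        D (\<lambda>p. f p *\<^sub>R X p) Y = (\<lambda>p. f p *\<^sub>R D X Y p)) \<and>
     (\<forall>X Y Y'. vector_field A X \<longrightarrow> vector_field A Y \<longrightarrow> vector_field A Y' \<longrightarrow>
        D X (\<lambda>p. Y p + Y' p) = (\<lambda>p. D X Y p + D X Y' p)) \<and>
     (\<forall>f X Y. smooth_fun A f \<longrightarrow> vector_field A X \<longrightarrow> vector_field A Y \<longrightarrow>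
        D X (\<lambda>p. f p *\<^sub>R Y p) = (\<lambda>p. dir_deriv A X f p *\<^sub>R Y p + f p *\<^sub>R D X Y p))"

definition torsion ::
  "('m, 'k::finite) chart set \<Rightarrow> ('m, 'k) connection \<Rightarrow>
   ('m, 'k) field \<Rightarrow> ('m, 'k) field \<Rightarrow> ('m, 'k) field" where
  "torsion A D X Y p = D X Y p - D Y X p - lie_bracket A X Y p"

definition parallel_torsion :: "('m, 'k::finite) chart set \<Rightarrow> ('m, 'k) connection \<Rightarrow> bool" where
  "parallel_torsion A D \<longleftrightarrow>
     (\<forall>X Y Z p. vector_field A X \<longrightarrow> vector_field A Y \<longrightarrow> vector_field A Z \<longrightarrow>
        D X (torsion A D Y Z) p - torsion A D (D X Y) Z p - torsion A D Y (D X Z) p = 0)"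

definition parallel_metric ::
  "('m, 'k::finite) chart set \<Rightarrow> ('m \<Rightarrow> real ^ 'k \<Rightarrow> real ^ 'k \<Rightarrow> real) \<Rightarrow>
   ('m, 'k) connection \<Rightarrow> bool" where
  "parallel_metric A g D \<longleftrightarrow>
     (\<forall>X Y Z p. vector_field A X \<longrightarrow> vector_field A Y \<longrightarrow> vector_field A Z \<longrightarrow>
        dir_deriv A X (\<lambda>q. g q (Y q) (Z q)) p - g p (D X Y p) (Z p) - g p (Y p) (D X Z p) = 0)"

definition levi_civita ::
  "('m, 'k::finite) chart set \<Rightarrow> ('m \<Rightarrow> real ^ 'k \<Rightarrow> real ^ 'k \<Rightarrow> real) \<Rightarrow>
   ('m, 'k) connection \<Rightarrow> bool" where
  "levi_civita A g D \<longleftrightarrow> linear_connection A D \<and> parallel_metric A g D \<and>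
     (\<forall>X Y p. vector_field A X \<longrightarrow> vector_field A Y \<longrightarrow> torsion A D X Y p = 0)"

definition cov_deriv_endo ::
  "('m, 'k) connection \<Rightarrow> ('m \<Rightarrow> real ^ 'k \<Rightarrow> real ^ 'k) \<Rightarrow>
   ('m, 'k) field \<Rightarrow> ('m, 'k) field \<Rightarrow> ('m, 'k) field" where
  "cov_deriv_endo D P X Y p = D X (\<lambda>q. P q (Y q)) p - P p (D X Y p)"

definition natural_connection ::
  "('m, 'k::finite) chart set \<Rightarrow> ('m \<Rightarrow> real ^ 'k \<Rightarrow> real ^ 'k) \<Rightarrow>
   ('m \<Rightarrow> real ^ 'k \<Rightarrow> real ^ 'k \<Rightarrow> real) \<Rightarrow> ('m, 'k) connection \<Rightarrow> bool" where
  "natural_connection A P g D \<longleftrightarrow> linear_connection A D \<and> parallel_metric A g D \<and>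
     (\<forall>X Y p. vector_field A X \<longrightarrow> vector_field A Y \<longrightarrow> cov_deriv_endo D P X Y p = 0)"


section \<open>Riemannian almost product manifolds\<close>

text \<open>The dimension is \<open>2 n\<close>. Since \<open>CARD('k) > 0\<close>, this forces \<open>n \<ge> 1\<close>.\<close>

definition riemannian_almost_product ::
  "('m::{t2_space, second_countable_topology}, 'k::finite) chart set \<Rightarrow> nat \<Rightarrow>
   ('m \<Rightarrow> real ^ 'k \<Rightarrow> real ^ 'k) \<Rightarrow> ('m \<Rightarrow> real ^ 'k \<Rightarrow> real ^ 'k \<Rightarrow> real) \<Rightarrow> bool" where
  "riemannian_almost_product A n P g \<longleftrightarrow>
     smooth_atlas A \<and> CARD('k) = 2 * n \<and>
     endomorphism_field A P \<and> riemannian_metric A g \<and>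
     (\<forall>p x. P p (P p x) = x) \<and>
     (\<forall>p x y. g p (P p x) (P p y) = g p x y) \<and>
     (\<forall>p. trace (matrix (P p)) = 0)"

text \<open>The covariant derivative of \<open>P\<close> is evaluated on tangent vectors by extending them to smooth
  vector fields; by tensoriality the result does not depend on the extensions.\<close>

definition extension ::
  "('m, 'k::finite) chart set \<Rightarrow> 'm \<Rightarrow> real ^ 'k \<Rightarrow> ('m, 'k) field" where
  "extension A p v = (SOME X. vector_field A X \<and> X p = v)"

definition F_tensor ::
  "('m, 'k::finite) chart set \<Rightarrow> ('m \<Rightarrow> real ^ 'k \<Rightarrow> real ^ 'k) \<Rightarrow>
   ('m \<Rightarrow> real ^ 'k \<Rightarrow> real ^ 'k \<Rightarrow> real) \<Rightarrow> ('m, 'k) connection \<Rightarrow>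
   'm \<Rightarrow> real ^ 'k \<Rightarrow> real ^ 'k \<Rightarrow> real ^ 'k \<Rightarrow> real" where
  "F_tensor A P g D p x y z =
     g p (cov_deriv_endo D P (extension A p x) (extension A p y) p) z"

text \<open>The trace is taken over the coordinate basis \<open>axis i 1\<close> of the tangent space; any other
  basis gives the same value.\<close>

definition gram :: "('m \<Rightarrow> real ^ 'k \<Rightarrow> real ^ 'k \<Rightarrow> real) \<Rightarrow> 'm \<Rightarrow> real ^ 'k ^ 'k" where
  "gram g p = (\<chi> i j. g p (axis i 1) (axis j 1))"

definition theta ::
  "('m, 'k::finite) chart set \<Rightarrow> ('m \<Rightarrow> real ^ 'k \<Rightarrow> real ^ 'k) \<Rightarrow>
   ('m \<Rightarrow> real ^ 'k \<Rightarrow> real ^ 'k \<Rightarrow> real) \<Rightarrow> ('m, 'k) connection \<Rightarrow>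
   'm \<Rightarrow> real ^ 'k \<Rightarrow> real" where
  "theta A P g D p x =
     (\<Sum>i\<in>UNIV. \<Sum>j\<in>UNIV.
        matrix_inv (gram g p) $ i $ j * F_tensor A P g D p (axis i 1) (axis j 1) x)"

definition Omega ::
  "('m, 'k::finite) chart set \<Rightarrow> ('m \<Rightarrow> real ^ 'k \<Rightarrow> real ^ 'k) \<Rightarrow>
   ('m \<Rightarrow> real ^ 'k \<Rightarrow> real ^ 'k \<Rightarrow> real) \<Rightarrow> ('m, 'k) connection \<Rightarrow> ('m, 'k) field" where
  "Omega A P g D p = (THE w. \<forall>x. g p w x = theta A P g D p x)"

definition W1 ::
  "('m, 'k::finite) chart set \<Rightarrow> nat \<Rightarrow> ('m \<Rightarrow> real ^ 'k \<Rightarrow> real ^ 'k) \<Rightarrow>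
   ('m \<Rightarrow> real ^ 'k \<Rightarrow> real ^ 'k \<Rightarrow> real) \<Rightarrow> ('m, 'k) connection \<Rightarrow> bool" where
  "W1 A n P g D \<longleftrightarrow>
     (let \<theta> = theta A P g D in
      \<forall>p x y z. F_tensor A P g D p x y z =
        1 / (2 * real n) *
          (g p x y * \<theta> p z - g p x (P p y) * \<theta> p (P p z)
         + g p x z * \<theta> p y - g p x (P p z) * \<theta> p (P p y)))"

definition W3_bar ::
  "('m, 'k::finite) chart set \<Rightarrow> nat \<Rightarrow> ('m \<Rightarrow> real ^ 'k \<Rightarrow> real ^ 'k) \<Rightarrow>
   ('m \<Rightarrow> real ^ 'k \<Rightarrow> real ^ 'k \<Rightarrow> real) \<Rightarrow> ('m, 'k) connection \<Rightarrow> bool" where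
  "W3_bar A n P g D \<longleftrightarrow>
     (let \<theta> = theta A P g D in
      (\<forall>p x y z. F_tensor A P g D p x y z =
        1 / (2 * real n) *
          ((g p x y + g p x (P p y)) * \<theta> p z + (g p x z + g p x (P p z)) * \<theta> p y)) \<and>
      (\<forall>p x. \<theta> p (P p x) = - \<theta> p x))"

definition W6_bar ::
  "('m, 'k::finite) chart set \<Rightarrow> nat \<Rightarrow> ('m \<Rightarrow> real ^ 'k \<Rightarrow> real ^ 'k) \<Rightarrow>
   ('m \<Rightarrow> real ^ 'k \<Rightarrow> real ^ 'k \<Rightarrow> real) \<Rightarrow> ('m, 'k) connection \<Rightarrow> bool" where
  "W6_bar A n P g D \<longleftrightarrow>
     (let \<theta> = theta A P g D in
      (\<forall>p x y z. F_tensor A P g D p x y z =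
        1 / (2 * real n) *
          ((g p x y - g p x (P p y)) * \<theta> p z + (g p x z - g p x (P p z)) * \<theta> p y)) \<and>
      (\<forall>p x. \<theta> p (P p x) = \<theta> p x))"

text \<open>The member with parameters \<open>l\<close>, \<open>m\<close> of the 2-parametric family; \<open>D\<close> is the Levi-Civita
  connection.\<close>

definition nat_conn ::
  "('m, 'k::finite) chart set \<Rightarrow> nat \<Rightarrow> ('m \<Rightarrow> real ^ 'k \<Rightarrow> real ^ 'k) \<Rightarrow>
   ('m \<Rightarrow> real ^ 'k \<Rightarrow> real ^ 'k \<Rightarrow> real) \<Rightarrow> ('m, 'k) connection \<Rightarrow>
   real \<Rightarrow> real \<Rightarrow> ('m, 'k) connection" where
  "nat_conn A n P g D l m X Y p =
     (let \<theta> = theta A P g D p; \<Omega> = Omega A P g D p; x = X p; y = Y p; m' = m + 1 / (2 * real n) in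
        D X Y p
      + g p x (P p y) *\<^sub>R (l *\<^sub>R P p \<Omega> + m *\<^sub>R \<Omega>)
      - (l * \<theta> (P p y) + m * \<theta> y) *\<^sub>R P p x
      + g p x y *\<^sub>R (l *\<^sub>R \<Omega> + m' *\<^sub>R P p \<Omega>)
      - (l * \<theta> y + m' * \<theta> (P p y)) *\<^sub>R x)"

end

theory Submission
  imports Defs
begin

text \<open>Write \<open>T\<close> for the torsion of the natural connection \<open>\<nabla>'\<close> with parameters \<open>l\<close> and \<open>m\<close>. In
  \<open>T\<close> the terms with \<open>\<Omega>\<close> cancel by symmetry and the Levi-Civita connection cancels the bracket,
  so that \<open>T(x, y)\<close> is a combination of \<open>x\<close>, \<open>P x\<close>, \<open>y\<close>, \<open>P y\<close> with values of \<open>\<theta>\<close> as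
  coefficients (\<open>torsion_nat_conn\<close>). The key observation is that \<open>\<theta>\<close> can be recovered from \<open>T\<close>
  and \<open>P\<close>, independently of the parameters: \<open>2 n (P T(x, y) - T(x, P y)) = \<theta>(y) x - \<theta>(P y) P x\<close>
  (\<open>torsion_tensor_commutator\<close>).

  If \<open>T\<close> is parallel, so is the left-hand side, because \<open>\<nabla>'P = 0\<close>. Hence the covariant
  derivative of \<open>\<theta>\<close> satisfies \<open>(\<nabla>'\<theta>)(y) x = (\<nabla>'\<theta>)(P y) P x\<close> for all \<open>x\<close>; taking the trace over
  \<open>x\<close> and using \<open>tr P = 0\<close> shows that \<open>\<theta>\<close>, and with it \<open>\<theta> \<circ> P\<close>, is parallel (\<open>parallel_theta\<close>).
  The exterior derivative of a parallel form \<open>\<alpha>\<close> is \<open>\<alpha>(T(x, y))\<close>. From the formula for \<open>T\<close>, this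
  is \<open>0\<close> for \<open>\<alpha> = \<theta> \<circ> P\<close>, and it is \<open>(\<theta>(P x) \<theta>(y) - \<theta>(x) \<theta>(P y)) / (2 n)\<close> for \<open>\<alpha> = \<theta>\<close>, which
  vanishes as soon as \<open>\<theta> \<circ> P\<close> is \<open>\<theta>\<close> or \<open>- \<theta>\<close>, as in the two subclasses.

  Closedness includes smoothness. For \<open>\<theta>\<close> it comes from the same identity: its left-hand side is
  smooth, and the trace of its right-hand side over \<open>x\<close> is \<open>2 n \<theta>(y)\<close> (\<open>one_form_theta\<close>). Both
  uses of the trace involve vector fields on the whole manifold with prescribed values near a
  point. They are built from bump functions (\<open>coordinate_fields\<close>).\<close>

section \<open>Calculus of continuously differentiable maps\<close>

lemma Ck_on_cong:
  assumes "open S" "\<And>x. x \<in> S \<Longrightarrow> f x = g x" "Ck_on k S f"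
  shows "Ck_on k S g"
  using assms(2,3)
proof (induction k arbitrary: f g)
  case 0
  then show ?case using continuous_on_cong by fastforce
next
  case (Suc k)
  have der: "frechet_derivative f (at x) = frechet_derivative g (at x)" if "x \<in> S" for x
    using frechet_derivative_transform_within_open[of f x S g] Suc.prems that \<open>open S\<close>
    by (simp add: differentiable_on_eq_differentiable_at)
  have "g differentiable_on S"
    using Suc.prems \<open>open S\<close>
    by (simp add: differentiable_on_eq_differentiable_at differentiable_def)
      (metis has_derivative_transform_within_open)
  moreover have "Ck_on k S (\<lambda>x. frechet_derivative g (at x) v)" for v
    using Suc.IH[of "\<lambda>x. frechet_derivative f (at x) v" "\<lambda>x. frechet_derivative g (at x) v"]
      der Suc.prems by simp
  ultimately show ?case by simp
qed

lemma Ck_on_has_derivative: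
  assumes "Ck_on (Suc k) S f" "open S" "x \<in> S"
  shows "(f has_derivative frechet_derivative f (at x)) (at x)"
  using assms by (simp add: differentiable_on_eq_differentiable_at frechet_derivative_works)

text \<open>Lets an explicit formula for the derivative stand in for \<open>frechet_derivative\<close>, which it
  equals by uniqueness. Membership in all classes then follows by induction whenever the
  derivative is built from functions of the family under consideration.\<close>

lemma Ck_on_SucI:
  assumes "open S" "\<And>x. x \<in> S \<Longrightarrow> (f has_derivative f' x) (at x)"
    and "\<And>v. Ck_on k S (\<lambda>x. f' x v)"
  shows "Ck_on (Suc k) S f"
proof -
  have "f' x v = frechet_derivative f (at x) v" if "x \<in> S" for x v
    using assms(2)[OF that] frechet_derivative_at by metis
  then have "Ck_on k S (\<lambda>x. frechet_derivative f (at x) v)" for v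
    by (rule Ck_on_cong[OF \<open>open S\<close> _ assms(3)])
  moreover have "f differentiable_on S"
    using assms by (auto simp: differentiable_on_eq_differentiable_at differentiable_def)
  ultimately show ?thesis by simp
qed

lemma Ck_on_subset: "Ck_on k S f \<Longrightarrow> T \<subseteq> S \<Longrightarrow> Ck_on k T f"
  by (induction k arbitrary: f) (auto intro: continuous_on_subset differentiable_on_subset)

lemma Ck_on_local:
  assumes "open S" "\<And>x. x \<in> S \<Longrightarrow> \<exists>T. open T \<and> x \<in> T \<and> Ck_on k T f"
  shows "Ck_on k S f"
  using assms(2)
proof (induction k arbitrary: f)
  case 0
  then show ?case
    using \<open>open S\<close> by (metis Ck_on.simps(1) continuous_at_imp_continuous_on continuous_on_eq_continuous_at)
next
  case (Suc k)
  have "f differentiable_on S"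
    using Suc.prems \<open>open S\<close>
    by (metis Ck_on.simps(2) differentiable_on_eq_differentiable_at)
  moreover have "Ck_on k S (\<lambda>x. frechet_derivative f (at x) v)" for v
    by (rule Suc.IH) (use Suc.prems in force)
  ultimately show ?case by simp
qed

lemma Ck_on_SucD: "Ck_on (Suc k) S f \<Longrightarrow> Ck_on k S f"
proof (induction k arbitrary: f)
  case 0
  then show ?case by (simp add: differentiable_imp_continuous_on)
next
  case (Suc k)
  then show ?case by (metis Ck_on.simps(2))
qed

lemma Ck_on_const: "Ck_on k S (\<lambda>x. c)"
  by (induction k arbitrary: c) simp_all

lemma Ck_on_add:
  assumes "open S" "Ck_on k S f" "Ck_on k S g"
  shows "Ck_on k S (\<lambda>x. f x + g x)"
  using assms(2,3)
proof (induction k arbitrary: f g)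
  case 0
  then show ?case by (simp add: continuous_on_add)
next
  case (Suc k)
  show ?case
    by (rule Ck_on_SucI[OF \<open>open S\<close>
          has_derivative_add[OF Ck_on_has_derivative Ck_on_has_derivative]])
      (use Suc \<open>open S\<close> in auto)
qed

lemma Ck_on_linear:
  assumes "open S" "bounded_linear L" "Ck_on k S f"
  shows "Ck_on k S (\<lambda>x. L (f x))"
  using assms(3)
proof (induction k arbitrary: f)
  case 0
  then show ?case by (simp add: bounded_linear.continuous_on[OF assms(2)])
next
  case (Suc k)
  show ?case
    by (rule Ck_on_SucI[OF \<open>open S\<close>
          bounded_linear.has_derivative[OF assms(2) Ck_on_has_derivative]])
      (use Suc \<open>open S\<close> in auto)
qed

lemma Ck_on_bilinear:
  assumes "open S" "bounded_bilinear B" "Ck_on k S f" "Ck_on k S g"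
  shows "Ck_on k S (\<lambda>x. B (f x) (g x))"
  using assms(3,4)
proof (induction k arbitrary: f g)
  case 0
  then show ?case by (simp add: bounded_bilinear.continuous_on[OF assms(2)])
next
  case (Suc k)
  show ?case
  proof (rule Ck_on_SucI[OF \<open>open S\<close>
        bounded_bilinear.FDERIV[OF assms(2) Ck_on_has_derivative Ck_on_has_derivative]])
    fix v
    have "Ck_on k S f" "Ck_on k S g" using Suc.prems Ck_on_SucD by blast+
    then show "Ck_on k S (\<lambda>x. B (f x) (frechet_derivative g (at x) v) +
        B (frechet_derivative f (at x) v) (g x))"
      using Suc.prems by (auto intro!: Ck_on_add[OF \<open>open S\<close>] Suc.IH)
  qed (use Suc \<open>open S\<close> in auto)
qed

lemma Ck_on_sum:
  assumes "open S" "\<And>i. i \<in> I \<Longrightarrow> Ck_on k S (f i)"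
  shows "Ck_on k S (\<lambda>x. \<Sum>i\<in>I. f i x)"
  using assms(2)
  by (induction I rule: infinite_finite_induct) (auto intro: Ck_on_const Ck_on_add[OF \<open>open S\<close>])

text \<open>Expanding \<open>h x\<close> in the standard basis turns \<open>L x (h x)\<close> into a finite sum of products of
  scalar components with the functions \<open>\<lambda>x. L x b\<close>. Both the chain rule and the evaluation of
  tensor fields in a chart have this shape.\<close>

lemma Ck_on_linear_family:
  fixes h :: "'a::euclidean_space \<Rightarrow> 'b::euclidean_space"
  assumes "open S" "\<And>x. x \<in> S \<Longrightarrow> linear (L x)"
    and "\<And>b. Ck_on k S (\<lambda>x. L x b)" "Ck_on k S h"
  shows "Ck_on k S (\<lambda>x. L x (h x))"
proof -
  have hb: "Ck_on k S (\<lambda>x. h x \<bullet> b)" for b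
    by (rule Ck_on_linear[OF assms(1) bounded_linear_inner_left assms(4)])
  have "Ck_on k S (\<lambda>x. \<Sum>b\<in>Basis. (h x \<bullet> b) *\<^sub>R L x b)"
    by (intro Ck_on_sum[OF assms(1)]
        Ck_on_bilinear[OF assms(1) bounded_bilinear_scaleR hb assms(3)])
  then show ?thesis
  proof (rule Ck_on_cong[OF assms(1), rotated])
    fix x assume "x \<in> S"
    then have "(\<Sum>b\<in>Basis. (h x \<bullet> b) *\<^sub>R L x b) = L x (\<Sum>b\<in>Basis. (h x \<bullet> b) *\<^sub>R b)"
      by (simp add: assms(2) linear_sum linear_cmul)
    then show "(\<Sum>b\<in>Basis. (h x \<bullet> b) *\<^sub>R L x b) = L x (h x)"
      by (simp only: euclidean_representation)
  qed
qed

text \<open>By the chain rule, the derivative of the composition in direction \<open>v\<close> is the linear map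
  \<open>g' (f x)\<close> applied to \<open>f' x v\<close>. The entries \<open>g' (f x) b\<close> are again compositions with \<open>f\<close>, one
  class lower, so the induction runs over all outer functions at once.\<close>

lemma Ck_on_compose:
  fixes f :: "'a::euclidean_space \<Rightarrow> 'b::euclidean_space"
  assumes "open S" "open T" "f ` S \<subseteq> T" "Ck_on k S f" "Ck_on k T g"
  shows "Ck_on k S (\<lambda>x. g (f x))"
  using assms(4,5)
proof (induction k arbitrary: g)
  case 0
  then show ?case
    using assms(3) continuous_on_compose2[of T g S f] by simp
next
  case (Suc k)
  define g' where "g' y = frechet_derivative g (at y)" for y
  define f' where "f' x = frechet_derivative f (at x)" for x
  have gd: "(g has_derivative g' y) (at y)" if "y \<in> T" for y
    unfolding g'_def using Ck_on_has_derivative[OF Suc.prems(2) assms(2) that] .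
  have fd: "(f has_derivative f' x) (at x)" if "x \<in> S" for x
    unfolding f'_def using Ck_on_has_derivative[OF Suc.prems(1) assms(1) that] .
  have cd: "((\<lambda>x. g (f x)) has_derivative (\<lambda>v. g' (f x) (f' x v))) (at x)" if "x \<in> S" for x
    by (rule has_derivative_compose[OF fd[OF that] gd]) (use that assms(3) in auto)
  show ?case
  proof (rule Ck_on_SucI[OF \<open>open S\<close> cd])
    show "Ck_on k S (\<lambda>x. g' (f x) (f' x v))" for v
    proof (rule Ck_on_linear_family[OF assms(1)])
      show "linear (g' (f x))" if "x \<in> S" for x
        by (rule has_derivative_linear[OF gd]) (use assms(3) that in auto)
      show "Ck_on k S (\<lambda>x. g' (f x) b)" for b
        unfolding g'_def
        by (rule Suc.IH[OF Ck_on_SucD[OF Suc.prems(1)],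
              where g = "\<lambda>y. frechet_derivative g (at y) b"])
          (use Suc.prems(2) in simp)
      show "Ck_on k S (\<lambda>x. f' x v)"
        using Suc.prems(1) by (simp add: f'_def)
    qed
  qed
qed

lemma smooth_on_has_derivative:
  assumes "smooth_on S f" "open S" "x \<in> S"
  shows "(f has_derivative frechet_derivative f (at x)) (at x)"
  using assms Ck_on_has_derivative smooth_on_def by blast

lemma smooth_on_frechet_derivative:
  "smooth_on S f \<Longrightarrow> smooth_on S (\<lambda>x. frechet_derivative f (at x) v)"
  by (metis Ck_on.simps(2) smooth_on_def)

lemma smooth_on_cong:
  "open S \<Longrightarrow> (\<And>x. x \<in> S \<Longrightarrow> f x = g x) \<Longrightarrow> smooth_on S f \<Longrightarrow> smooth_on S g"
  unfolding smooth_on_def by (blast intro: Ck_on_cong[where f = f])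

lemma smooth_on_subset: "smooth_on S f \<Longrightarrow> T \<subseteq> S \<Longrightarrow> smooth_on T f"
  unfolding smooth_on_def by (blast intro: Ck_on_subset[where S = S])

lemma smooth_on_local:
  assumes "open S" "\<And>x. x \<in> S \<Longrightarrow> \<exists>T. open T \<and> x \<in> T \<and> smooth_on T f"
  shows "smooth_on S f"
  unfolding smooth_on_def
proof
  fix k show "Ck_on k S f"
    by (rule Ck_on_local[OF assms(1)]) (use assms(2) in \<open>auto simp: smooth_on_def\<close>)
qed

lemma smooth_on_const: "smooth_on S (\<lambda>x. c)"
  by (simp add: smooth_on_def Ck_on_const)

lemma smooth_on_linear:
  "open S \<Longrightarrow> bounded_linear L \<Longrightarrow> smooth_on S f \<Longrightarrow> smooth_on S (\<lambda>x. L (f x))"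
  by (simp add: smooth_on_def Ck_on_linear[where L = L and f = f])

lemma smooth_on_id: "open S \<Longrightarrow> smooth_on S (\<lambda>x. x)"
  unfolding smooth_on_def
proof
  fix k assume "open S"
  then show "Ck_on k S (\<lambda>x. x)"
    by (cases k) (auto intro!: Ck_on_SucI[where f' = "\<lambda>x v. v"] Ck_on_const)
qed

lemma smooth_on_add:
  "open S \<Longrightarrow> smooth_on S f \<Longrightarrow> smooth_on S g \<Longrightarrow> smooth_on S (\<lambda>x. f x + g x)"
  by (simp add: smooth_on_def Ck_on_add)

lemma smooth_on_diff:
  assumes "open S" "smooth_on S f" "smooth_on S g"
  shows "smooth_on S (\<lambda>x. f x - g x)"
  using smooth_on_add[OF assms(1,2)
      smooth_on_linear[OF assms(1) bounded_linear_minus[OF bounded_linear_ident] assms(3)]]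
  by simp

lemma smooth_on_sum:
  "open S \<Longrightarrow> (\<And>i. i \<in> I \<Longrightarrow> smooth_on S (f i)) \<Longrightarrow> smooth_on S (\<lambda>x. \<Sum>i\<in>I. f i x)"
  by (simp add: smooth_on_def Ck_on_sum)

lemma smooth_on_scaleR:
  "open S \<Longrightarrow> smooth_on S f \<Longrightarrow> smooth_on S g \<Longrightarrow> smooth_on S (\<lambda>x. f x *\<^sub>R g x)"
  by (simp add: smooth_on_def Ck_on_bilinear[OF _ bounded_bilinear_scaleR])

lemma smooth_on_mult:
  fixes f g :: "'a::euclidean_space \<Rightarrow> real"
  shows "open S \<Longrightarrow> smooth_on S f \<Longrightarrow> smooth_on S g \<Longrightarrow> smooth_on S (\<lambda>x. f x * g x)"
  using smooth_on_scaleR[of S f g] by simp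

lemma smooth_on_linear_family:
  fixes h :: "'a::euclidean_space \<Rightarrow> 'b::euclidean_space"
  assumes "open S" "\<And>x. x \<in> S \<Longrightarrow> linear (L x)"
    and "\<And>b. smooth_on S (\<lambda>x. L x b)" "smooth_on S h"
  shows "smooth_on S (\<lambda>x. L x (h x))"
  using Ck_on_linear_family[of S L _ h] assms by (simp add: smooth_on_def)

lemma smooth_on_compose:
  fixes f :: "'a::euclidean_space \<Rightarrow> 'b::euclidean_space"
  shows "open S \<Longrightarrow> open T \<Longrightarrow> f ` S \<subseteq> T \<Longrightarrow> smooth_on S f \<Longrightarrow> smooth_on T g \<Longrightarrow>
    smooth_on S (\<lambda>x. g (f x))"
  by (simp add: smooth_on_def Ck_on_compose[where T = T and f = f and g = g])

lemma smooth_on_inverse: "smooth_on {0<..} (inverse :: real \<Rightarrow> real)"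
  unfolding smooth_on_def
proof
  fix k show "Ck_on k {0<..} (inverse :: real \<Rightarrow> real)"
  proof (induction k)
    case 0
    have "continuous_on {0<..} (\<lambda>x::real. inverse x)"
      by (rule continuous_on_inverse[OF continuous_on_id]) auto
    then show ?case by simp
  next
    case (Suc k)
    show ?case
    proof (rule Ck_on_SucI[where f' = "\<lambda>x v. - (inverse x * v * inverse x)"])
      show "(inverse has_derivative (\<lambda>v. - (inverse x * v * inverse x))) (at x)"
        if "x \<in> {0<..}" for x :: real
        by (rule has_derivative_inverse') (use that in simp)
      show "Ck_on k {0<..} (\<lambda>x::real. - (inverse x * v * inverse x))" for v
        by (rule Ck_on_linear[OF _ bounded_linear_minus[OF bounded_linear_ident]
              Ck_on_bilinear[OF _ bounded_bilinear_mult
                Ck_on_bilinear[OF _ bounded_bilinear_mult Suc Ck_on_const] Suc]]) auto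
    qed simp
  qed
qed

section \<open>Bump functions\<close>

text \<open>A family containing the standard flat function \<open>exp (- 1 / t)\<close> and closed, up to linear
  combinations, under differentiation.\<close>

definition flat :: "nat \<Rightarrow> real \<Rightarrow> real" where
  "flat n t = (if t > 0 then (1 / t) ^ n * exp (- (1 / t)) else 0)"

lemma flat_tendsto_0: "(flat n \<longlongrightarrow> 0) (at 0)"
proof -
  have "((\<lambda>x. x ^ n / exp x) \<longlongrightarrow> 0) (at_top :: real filter)"
    by (rule tendsto_power_div_exp_0)
  then have "((\<lambda>t. inverse t ^ n / exp (inverse t)) \<longlongrightarrow> 0) (at_right (0::real))"
    by (rule filterlim_compose[OF _ filterlim_inverse_at_top_right])
  then have right: "(flat n \<longlongrightarrow> 0) (at_right 0)"
    by (rule Lim_transform_eventually)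
      (auto simp: flat_def eventually_at_filter exp_minus divide_simps)
  have "(flat n \<longlongrightarrow> 0) (at_left 0)"
    by (rule Lim_transform_eventually[OF tendsto_const])
      (auto simp: flat_def eventually_at_filter)
  with right show ?thesis by (simp add: filterlim_split_at)
qed

text \<open>At \<open>0\<close> the difference quotient of \<open>flat n\<close> is \<open>flat (n + 1)\<close>, which tends to \<open>0\<close>.\<close>

lemma flat_has_derivative:
  "(flat n has_real_derivative flat (n + 2) t - real n * flat (n + 1) t) (at t)"
proof (cases t "0::real" rule: linorder_cases)
  case less
  have "((\<lambda>_. 0) has_real_derivative 0) (at t)" by simp
  then have "(flat n has_real_derivative 0) (at t)"
    by (rule has_field_derivative_transform_within_open[where S = "{..<0}"])
      (use less in \<open>auto simp: flat_def\<close>)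
  then show ?thesis using less by (simp add: flat_def)
next
  case equal
  have "((\<lambda>h. flat n h / h) \<longlongrightarrow> 0) (at 0)"
    by (rule Lim_transform_eventually[OF flat_tendsto_0[of "Suc n"]])
      (auto simp: flat_def eventually_at_filter)
  then show ?thesis using equal by (simp add: DERIV_def flat_def)
next
  case greater
  have "((\<lambda>t. (1 / t) ^ n * exp (- (1 / t))) has_real_derivative
      flat (n + 2) t - real n * flat (n + 1) t) (at t)"
  proof -
    have inv: "((\<lambda>t. 1 / t) has_real_derivative - (1 / t)\<^sup>2) (at t)"
      using greater by (auto intro!: derivative_eq_intros simp: power2_eq_square)
    show ?thesis
    proof (rule DERIV_cong[OF DERIV_mult[OF DERIV_power[OF inv]
          DERIV_chain2[OF DERIV_exp DERIV_minus[OF inv]]]])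
      define s where "s = 1 / t"
      show "real n * (- (1 / t)\<^sup>2 * (1 / t) ^ (n - Suc 0)) * exp (- (1 / t)) +
          exp (- (1 / t)) * (- (- (1 / t)\<^sup>2)) * (1 / t) ^ n = flat (n + 2) t - real n * flat (n + 1) t"
        using greater
        by (cases n) (simp_all add: flat_def algebra_simps power2_eq_square flip: s_def)
    qed
  qed
  then show ?thesis
    by (rule has_field_derivative_transform_within_open[where S = "{0<..}"])
      (use greater in \<open>auto simp: flat_def\<close>)
qed

lemma smooth_on_flat: "smooth_on UNIV (flat n)"
  unfolding smooth_on_def
proof
  fix k show "Ck_on k UNIV (flat n)"
  proof (induction k arbitrary: n)
    case 0
    then show ?case
      by (simp add: continuous_at_imp_continuous_on DERIV_isCont[OF flat_has_derivative])
  next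
    case (Suc k)
    have "Ck_on k UNIV (\<lambda>t. (flat (n + 2) t + - real n * flat (n + 1) t) * v)" for v
      by (intro Ck_on_bilinear[OF _ bounded_bilinear_mult] Ck_on_add Ck_on_const Suc) auto
    then show ?case
      using flat_has_derivative
      by (intro Ck_on_SucI[where f' = "\<lambda>t v. (flat (n + 2) t + - real n * flat (n + 1) t) * v"])
        (auto simp: has_field_derivative_def)
  qed
qed

lemma bump_function:
  fixes a :: "'a::euclidean_space"
  assumes "r > 0"
  obtains f :: "'a \<Rightarrow> real" where "smooth_on UNIV f"
    and "\<And>x. x \<in> ball a r \<Longrightarrow> f x = 1" and "\<And>x. x \<notin> cball a (2 * r) \<Longrightarrow> f x = 0"
proof -
  \<comment> \<open>a smooth step, equal to \<open>0\<close> for \<open>t \<le> 0\<close> and to \<open>1\<close> for \<open>t \<ge> 1\<close>\<close>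
  define s where "s t = flat 0 t * inverse (flat 0 t + flat 0 (1 - t))" for t
  have pos: "flat 0 t + flat 0 (1 - t) > 0" for t
    by (auto simp: flat_def add_pos_pos)
  have "smooth_on UNIV (\<lambda>t. flat 0 (1 - t))"
    by (rule smooth_on_compose[OF open_UNIV open_UNIV subset_UNIV
          smooth_on_diff[OF open_UNIV smooth_on_const smooth_on_id[OF open_UNIV]] smooth_on_flat])
  then have "smooth_on UNIV (\<lambda>t. inverse (flat 0 t + flat 0 (1 - t)))"
    by (intro smooth_on_compose[OF _ _ _ _ smooth_on_inverse] smooth_on_add smooth_on_flat)
      (use pos in auto)
  then have s: "smooth_on UNIV s"
    unfolding s_def by (intro smooth_on_mult smooth_on_flat) auto
  \<comment> \<open>at least \<open>1\<close> at distance at most \<open>r\<close> from \<open>a\<close>, and negative beyond distance \<open>2 * r\<close>\<close>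
  define q where "q x = 2 - (x - a) \<bullet> (x - a) / r\<^sup>2" for x
  have d: "smooth_on UNIV (\<lambda>x. x - a)"
    by (intro smooth_on_diff smooth_on_id smooth_on_const) auto
  have "smooth_on UNIV (\<lambda>x. (x - a) \<bullet> (x - a))"
    using d by (simp add: smooth_on_def Ck_on_bilinear[OF _ bounded_bilinear_inner])
  then have "smooth_on UNIV (\<lambda>x. (x - a) \<bullet> (x - a) / r\<^sup>2)"
    by (intro smooth_on_linear[OF _ bounded_linear_divide]) auto
  then have "smooth_on UNIV q"
    unfolding q_def by (intro smooth_on_diff smooth_on_const) auto
  then have "smooth_on UNIV (\<lambda>x. s (q x))"
    by (intro smooth_on_compose[OF _ _ _ _ s]) auto
  moreover have "s (q x) = 1" if "x \<in> ball a r" for x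
  proof -
    have "norm (x - a) < r" using that by (simp add: dist_norm norm_minus_commute)
    then have "(x - a) \<bullet> (x - a) < r\<^sup>2" 
      by (simp add: power_strict_mono flip: power2_norm_eq_inner)
    then have "q x > 1" using assms by (simp add: q_def field_simps)
    then show ?thesis by (simp add: s_def flat_def)
  qed
  moreover have "s (q x) = 0" if "x \<notin> cball a (2 * r)" for x
  proof -
    have "norm (x - a) > 2 * r" using that by (simp add: dist_norm norm_minus_commute)
    then have "(x - a) \<bullet> (x - a) > (2 * r)\<^sup>2" 
      using assms power_strict_mono[of "2 * r" "norm (x - a)" 2]
      by (simp add: power2_norm_eq_inner)
    then have "4 * r\<^sup>2 < (x - a) \<bullet> (x - a)" by (simp add: power_mult_distrib)
    moreover have "r\<^sup>2 > 0" using assms by simp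
    ultimately have "2 * r\<^sup>2 < (x - a) \<bullet> (x - a)" by linarith
    then have "q x < 0" using \<open>r\<^sup>2 > 0\<close> by (simp add: q_def field_simps)
    then show ?thesis by (simp add: s_def flat_def)
  qed
  ultimately show ?thesis using that by blast
qed

section \<open>Changes of coordinates\<close>

lemma param_coord: "is_chart c \<Longrightarrow> p \<in> dom_of c \<Longrightarrow> param c (coord c p) = p"
  by (meson homeomorphism_apply1 is_chart_def)

lemma coord_param: "is_chart c \<Longrightarrow> u \<in> img_of c \<Longrightarrow> coord c (param c u) = u"
  by (meson homeomorphism_apply2 is_chart_def)

lemma param_in_dom: "is_chart c \<Longrightarrow> u \<in> img_of c \<Longrightarrow> param c u \<in> dom_of c"
  by (metis homeomorphism_image2 imageI is_chart_def)

lemma open_coord_image: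
  assumes "is_chart c" "open U"
  shows "open (coord c ` (dom_of c \<inter> U))"
proof -
  have "openin (top_of_set (img_of c)) (coord c ` (dom_of c \<inter> U))"
    using assms unfolding is_chart_def
    by (metis homeomorphism_imp_open_map openin_open_Int)
  then show ?thesis
    using assms(1) openin_open_trans is_chart_def by blast
qed

lemma open_img_of: "is_chart c \<Longrightarrow> open (img_of c)"
  by (simp add: is_chart_def)

context
  fixes A :: "('m::t2_space, 'k::finite) chart set"
  assumes atlas: "smooth_atlas A"
begin

lemma atlas_is_chart: "c \<in> A \<Longrightarrow> is_chart c"
  using atlas by (simp add: smooth_atlas_def)

lemma transition_smooth:
  "c \<in> A \<Longrightarrow> d \<in> A \<Longrightarrow> smooth_on (coord c ` (dom_of c \<inter> dom_of d)) (coord d \<circ> param c)"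
  using atlas by (simp add: smooth_atlas_def)

lemma open_overlap: "c \<in> A \<Longrightarrow> d \<in> A \<Longrightarrow> open (coord c ` (dom_of c \<inter> dom_of d))"
  using atlas_is_chart is_chart_def open_coord_image by blast

lemma transition_has_derivative:
  assumes "c \<in> A" "d \<in> A" "p \<in> dom_of c" "p \<in> dom_of d"
  shows "((coord d \<circ> param c) has_derivative coord_change c d p) (at (coord c p))"
  unfolding coord_change_def
  by (rule smooth_on_has_derivative[OF transition_smooth open_overlap]) (use assms in auto)

lemma linear_coord_change:
  "c \<in> A \<Longrightarrow> d \<in> A \<Longrightarrow> p \<in> dom_of c \<Longrightarrow> p \<in> dom_of d \<Longrightarrow> linear (coord_change c d p)"
  using transition_has_derivative has_derivative_linear by blast

lemma coord_change_trans:
  assumes "c \<in> A" "d \<in> A" "e \<in> A" "p \<in> dom_of c" "p \<in> dom_of d" "p \<in> dom_of e"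
  shows "coord_change d e p (coord_change c d p v) = coord_change c e p v"
proof -
  have pc: "(coord d \<circ> param c) (coord c p) = coord d p"
    using assms by (simp add: param_coord atlas_is_chart)
  have "((coord e \<circ> param d) \<circ> (coord d \<circ> param c) has_derivative
      coord_change d e p \<circ> coord_change c d p) (at (coord c p))"
    using diff_chain_at[OF transition_has_derivative[of c d p]] assms pc
      transition_has_derivative[of d e p] by simp
  then have "(coord e \<circ> param c has_derivative
      coord_change d e p \<circ> coord_change c d p) (at (coord c p))"
    by (rule has_derivative_transform_within_open[OF _ open_overlap[of c d]])
      (use assms in \<open>auto simp: param_coord atlas_is_chart\<close>)
  then have "coord_change d e p \<circ> coord_change c d p = coord_change c e p"
    using transition_has_derivative[of c e p] assms has_derivative_unique by blast
  then show ?thesis by (metis comp_apply)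
qed

lemma coord_change_self:
  assumes "c \<in> A" "p \<in> dom_of c"
  shows "coord_change c c p v = v"
proof -
  have "((\<lambda>u. u) has_derivative (\<lambda>u. u)) (at (coord c p))" by simp
  then have "((coord c \<circ> param c) has_derivative (\<lambda>u. u)) (at (coord c p))"
    by (rule has_derivative_transform_within_open[OF _ open_overlap[of c c]])
      (use assms in \<open>auto simp: param_coord atlas_is_chart\<close>)
  then have "coord_change c c p = (\<lambda>u. u)"
    using transition_has_derivative[of c c p] assms has_derivative_unique by blast
  then show ?thesis by simp
qed

lemma smooth_on_coord_change:
  assumes "c \<in> A" "d \<in> A"
  shows "smooth_on (coord d ` (dom_of d \<inter> dom_of c)) (\<lambda>u. coord_change c d (param d u) v)"
  unfolding coord_change_def
proof (rule smooth_on_compose[where f = "\<lambda>u. coord c (param d u)"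
      and g = "\<lambda>x. frechet_derivative (coord d \<circ> param c) (at x) v"])
  show "smooth_on (coord d ` (dom_of d \<inter> dom_of c)) (\<lambda>u. coord c (param d u))"
    using transition_smooth[of d c] assms by (simp add: comp_def)
  show "smooth_on (coord c ` (dom_of c \<inter> dom_of d))
      (\<lambda>x. frechet_derivative (coord d \<circ> param c) (at x) v)"
    using transition_smooth[of c d] assms by (simp add: smooth_on_frechet_derivative)
  show "(\<lambda>u. coord c (param d u)) ` coord d ` (dom_of d \<inter> dom_of c)
      \<subseteq> coord c ` (dom_of c \<inter> dom_of d)"
    using assms by (auto simp: param_coord atlas_is_chart)
qed (use assms open_overlap in auto)

lemma chart_at: "chart_at A p \<in> A" "p \<in> dom_of (chart_at A p)"
proof -
  have "p \<in> (\<Union>c\<in>A. dom_of c)"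
    using atlas by (simp add: smooth_atlas_def)
  then have "\<exists>c. c \<in> A \<and> p \<in> dom_of c" by blast
  then show "chart_at A p \<in> A" "p \<in> dom_of (chart_at A p)"
    unfolding chart_at_def by (metis (mono_tags, lifting) someI_ex)+
qed

lemma linear_to_chart: "c \<in> A \<Longrightarrow> p \<in> dom_of c \<Longrightarrow> linear (to_chart A c p)"
  unfolding to_chart_def by (simp add: linear_coord_change chart_at)

lemma linear_from_chart: "c \<in> A \<Longrightarrow> p \<in> dom_of c \<Longrightarrow> linear (from_chart A c p)"
  unfolding from_chart_def by (simp add: linear_coord_change chart_at)

lemma from_chart_to_chart:
  "c \<in> A \<Longrightarrow> p \<in> dom_of c \<Longrightarrow> from_chart A c p (to_chart A c p v) = v"
  unfolding to_chart_def from_chart_def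
  by (simp add: coord_change_trans coord_change_self chart_at)

lemma to_chart_from_chart:
  "c \<in> A \<Longrightarrow> d \<in> A \<Longrightarrow> p \<in> dom_of c \<Longrightarrow> p \<in> dom_of d \<Longrightarrow>
    to_chart A d p (from_chart A c p v) = coord_change c d p v"
  unfolding to_chart_def from_chart_def
  by (simp add: coord_change_trans chart_at)

lemma field_rep_apply: "field_rep A c X u = to_chart A c (param c u) (X (param c u))"
  by (simp add: field_rep_def Let_def)

text \<open>Together with \<open>smooth_on_linear_family\<close>, this reduces smoothness of a tensor field
  evaluated on vector fields to its components in the chart.\<close>

lemma field_eq_from_chart:
  "c \<in> A \<Longrightarrow> u \<in> img_of c \<Longrightarrow> X (param c u) = from_chart A c (param c u) (field_rep A c X u)"
  by (simp add: field_rep_apply from_chart_to_chart param_in_dom atlas_is_chart)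

section \<open>Smooth fields\<close>

lemma vector_field_add:
  assumes "vector_field A X" "vector_field A Y"
  shows "vector_field A (\<lambda>p. X p + Y p)"
  unfolding vector_field_def
proof
  fix c assume c: "c \<in> A"
  have op: "open (img_of c)" using c atlas_is_chart open_img_of by blast
  have "smooth_on (img_of c) (\<lambda>u. field_rep A c X u + field_rep A c Y u)"
    by (rule smooth_on_add[OF op]) (use assms c in \<open>simp_all add: vector_field_def\<close>)
  then show "smooth_on (img_of c) (field_rep A c (\<lambda>p. X p + Y p))"
    by (rule smooth_on_cong[OF op, rotated])
      (simp add: field_rep_apply linear_add[OF linear_to_chart] c param_in_dom atlas_is_chart)
qed

lemma vector_field_scale:
  assumes "smooth_fun A f" "vector_field A X"
  shows "vector_field A (\<lambda>p. f p *\<^sub>R X p)"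
  unfolding vector_field_def
proof
  fix c assume c: "c \<in> A"
  have op: "open (img_of c)" using c atlas_is_chart open_img_of by blast
  have "smooth_on (img_of c) (\<lambda>u. f (param c u) *\<^sub>R field_rep A c X u)"
    by (rule smooth_on_scaleR[OF op])
      (use assms c in \<open>simp_all add: vector_field_def smooth_fun_def comp_def\<close>)
  then show "smooth_on (img_of c) (field_rep A c (\<lambda>p. f p *\<^sub>R X p))"
    by (rule smooth_on_cong[OF op, rotated])
      (simp add: field_rep_apply linear_cmul[OF linear_to_chart] c param_in_dom atlas_is_chart)
qed

lemma smooth_fun_const: "smooth_fun A (\<lambda>p. k)"
  by (simp add: smooth_fun_def comp_def smooth_on_const)

lemma vector_field_diff:
  assumes "vector_field A X" "vector_field A Y"
  shows "vector_field A (\<lambda>p. X p - Y p)"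
  using vector_field_add[OF assms(1) vector_field_scale[OF smooth_fun_const[of "-1"] assms(2)]]
  by simp

lemma vector_field_endo:
  assumes P: "endomorphism_field A P" and X: "vector_field A X"
  shows "vector_field A (\<lambda>p. P p (X p))"
  unfolding vector_field_def
proof
  fix c assume c: "c \<in> A"
  have op: "open (img_of c)" using c atlas_is_chart open_img_of by blast
  have lin: "linear (\<lambda>v. to_chart A c (param c u) (P (param c u) (from_chart A c (param c u) v)))"
    if "u \<in> img_of c" for u
  proof -
    have p: "param c u \<in> dom_of c" using that c atlas_is_chart param_in_dom by blast
    have "linear (to_chart A c (param c u) \<circ> (P (param c u) \<circ> from_chart A c (param c u)))"
      by (intro linear_compose linear_to_chart linear_from_chart)
        (use p c P in \<open>auto simp: endomorphism_field_def\<close>)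
    then show ?thesis by (simp add: comp_def)
  qed
  have "smooth_on (img_of c) (\<lambda>u. to_chart A c (param c u)
      (P (param c u) (from_chart A c (param c u) (field_rep A c X u))))"
    by (rule smooth_on_linear_family[OF op lin])
      (use P X c in \<open>auto simp: endomorphism_field_def vector_field_def Let_def\<close>)
  then show "smooth_on (img_of c) (field_rep A c (\<lambda>p. P p (X p)))"
    by (rule smooth_on_cong[OF op, rotated])
      (simp add: field_rep_apply[of c "\<lambda>p. P p (X p)"] flip: field_eq_from_chart[OF c])
qed

lemma smooth_on_one_form_in_chart:
  assumes \<alpha>: "one_form A \<alpha>" and c: "c \<in> A" and h: "smooth_on (img_of c) h"
  shows "smooth_on (img_of c) (\<lambda>u. \<alpha> (param c u) (from_chart A c (param c u) (h u)))"
proof (rule smooth_on_linear_family[where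
      L = "\<lambda>u v. \<alpha> (param c u) (from_chart A c (param c u) v)" and h = h])
  have chart: "is_chart c" using c by (rule atlas_is_chart)
  show "open (img_of c)" using chart by (rule open_img_of)
  show "linear (\<lambda>v. \<alpha> (param c u) (from_chart A c (param c u) v))" if "u \<in> img_of c" for u
  proof -
    have p: "param c u \<in> dom_of c" using that chart param_in_dom by blast
    have "linear (\<alpha> (param c u) \<circ> from_chart A c (param c u))"
      by (intro linear_compose linear_from_chart)
        (use p c \<alpha> in \<open>auto simp: one_form_def\<close>)
    then show ?thesis by (simp add: comp_def)
  qed
  show "smooth_on (img_of c) (\<lambda>u. \<alpha> (param c u) (from_chart A c (param c u) b))" for b
    using \<alpha> c by (simp add: one_form_def Let_def)
qed (rule h)

lemma smooth_fun_one_form: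
  assumes \<alpha>: "one_form A \<alpha>" and X: "vector_field A X"
  shows "smooth_fun A (\<lambda>p. \<alpha> p (X p))"
  unfolding smooth_fun_def
proof
  fix c assume c: "c \<in> A"
  have op: "open (img_of c)" using c atlas_is_chart open_img_of by blast
  have "smooth_on (img_of c) (\<lambda>u. \<alpha> (param c u) (from_chart A c (param c u) (field_rep A c X u)))"
    using X c by (intro smooth_on_one_form_in_chart[OF \<alpha> c]) (simp add: vector_field_def)
  then show "smooth_on (img_of c) ((\<lambda>p. \<alpha> p (X p)) \<circ> param c)"
    by (rule smooth_on_cong[OF op, rotated]) (simp flip: field_eq_from_chart[OF c])
qed

lemma one_form_comp_endo:
  assumes \<alpha>: "one_form A \<alpha>" and P: "endomorphism_field A P"
  shows "one_form A (\<lambda>p x. \<alpha> p (P p x))"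
  unfolding one_form_def
proof (intro conjI allI ballI)
  show "linear (\<lambda>x. \<alpha> p (P p x))" for p
    using linear_compose[of "P p" "\<alpha> p"] \<alpha> P
    by (simp add: one_form_def endomorphism_field_def comp_def)
  fix c v assume c: "c \<in> A"
  then have chart: "is_chart c" by (rule atlas_is_chart)
  have "smooth_on (img_of c)
      (\<lambda>u. to_chart A c (param c u) (P (param c u) (from_chart A c (param c u) v)))"
    using P c by (simp add: endomorphism_field_def Let_def)
  then have "smooth_on (img_of c) (\<lambda>u. \<alpha> (param c u) (from_chart A c (param c u)
      (to_chart A c (param c u) (P (param c u) (from_chart A c (param c u) v)))))"
    by (rule smooth_on_one_form_in_chart[OF \<alpha> c])
  then show "smooth_on (img_of c)
      (\<lambda>u. let p = param c u in \<alpha> p (P p (from_chart A c p v)))"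
    by (rule smooth_on_cong[OF open_img_of[OF chart], rotated])
      (simp add: Let_def from_chart_to_chart[OF c param_in_dom[OF chart]])
qed

text \<open>The vector field with constant components \<open>v\<close> is cut off by a bump function whose support
  is a compact part of the chart. The neighbourhood \<open>W\<close> is chosen before \<open>v\<close>, so that it serves
  a whole coordinate frame.\<close>

lemma coordinate_fields:
  assumes c: "c \<in> A" and u0: "u0 \<in> img_of c"
  obtains W where "open W" "u0 \<in> W" "W \<subseteq> img_of c"
    and "\<And>v. \<exists>Z. vector_field A Z \<and>
      (\<forall>u\<in>W. Z (param c u) = from_chart A c (param c u) v)"
proof -
  have chart: "is_chart c" using c by (rule atlas_is_chart)
  have "\<exists>e>0. cball u0 e \<subseteq> img_of c"
    using u0 open_img_of[OF chart] open_contains_cball by metis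
  then obtain e where e: "e > 0" "cball u0 e \<subseteq> img_of c" by blast
  define r where "r = e / 2"
  have r: "r > 0" "cball u0 (2 * r) \<subseteq> img_of c" using e by (auto simp: r_def)
  obtain f where f: "smooth_on UNIV f" "\<And>x. x \<in> ball u0 r \<Longrightarrow> f x = (1::real)"
    "\<And>x. x \<notin> cball u0 (2 * r) \<Longrightarrow> f x = 0"
    using bump_function[OF r(1)] by metis
  \<comment> \<open>The support of the cut-off field is compact, hence closed in the Hausdorff manifold; around a
    point outside the chart the field therefore vanishes.\<close>
  define K where "K = param c ` cball u0 (2 * r)"
  have "compact K"
    unfolding K_def
    using chart r(2) by (intro compact_continuous_image compact_cball)
      (auto simp: is_chart_def homeomorphism_def intro: continuous_on_subset)
  then have K: "closed K" by (rule compact_imp_closed)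
  define Z where "Z v p = (if p \<in> dom_of c then f (coord c p) *\<^sub>R from_chart A c p v else 0)" for v p
  have "vector_field A (Z v)" for v
    unfolding vector_field_def
  proof
    fix d assume d: "d \<in> A"
    then have chart': "is_chart d" by (rule atlas_is_chart)
    show "smooth_on (img_of d) (field_rep A d (Z v))"
    proof (rule smooth_on_local)
      show "open (img_of d)" using chart' by (rule open_img_of)
      fix u assume u: "u \<in> img_of d"
      then have ud: "param d u \<in> dom_of d" "coord d (param d u) = u"
        using chart' by (simp_all add: param_in_dom coord_param)
      show "\<exists>T. open T \<and> u \<in> T \<and> smooth_on T (field_rep A d (Z v))"
      proof (cases "param d u \<in> dom_of c")
        case True
        let ?T = "coord d ` (dom_of d \<inter> dom_of c)"
        have op: "open ?T" using open_overlap c d by blast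
        have "smooth_on ?T (\<lambda>u. coord c (param d u))"
          using transition_smooth[of d c] c d by (simp add: comp_def)
        then have "smooth_on ?T (\<lambda>u. f (coord c (param d u)))"
          by (rule smooth_on_compose[OF op open_UNIV _ _ f(1), rotated]) auto
        then have "smooth_on ?T (\<lambda>u. f (coord c (param d u)) *\<^sub>R coord_change c d (param d u) v)"
          by (rule smooth_on_scaleR[OF op _ smooth_on_coord_change[OF c d]])
        then have "smooth_on ?T (field_rep A d (Z v))"
          by (rule smooth_on_cong[OF op, rotated])
            (auto simp: field_rep_apply Z_def param_coord chart' linear_cmul[OF linear_to_chart]
              to_chart_from_chart c d)
        moreover have "u \<in> ?T" using ud True by force
        ultimately show ?thesis using op by blast
      next
        case False
        let ?T = "coord d ` (dom_of d \<inter> - K)"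
        have op: "open ?T" using K chart' by (intro open_coord_image) auto
        have "Z v p = 0" if "p \<notin> K" for p
        proof (cases "p \<in> dom_of c")
          case True
          then have "coord c p \<notin> cball u0 (2 * r)"
            using that param_coord[OF chart] unfolding K_def by (metis imageI)
          then show ?thesis by (simp add: Z_def f(3))
        qed (simp add: Z_def)
        then have "field_rep A d (Z v) x = 0" if "x \<in> ?T" for x
          using that chart' by (auto simp: field_rep_apply param_coord linear_0[OF linear_to_chart[OF d]])
        then have smooth: "smooth_on ?T (field_rep A d (Z v))"
          by (intro smooth_on_cong[OF op _ smooth_on_const[of _ 0]]) simp
        have "K \<subseteq> dom_of c"
          unfolding K_def using r(2) param_in_dom[OF chart] by (meson image_subsetI subsetD)
        then have "param d u \<notin> K" using False by blast
        then have "u \<in> ?T" using ud by force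
        then show ?thesis using op smooth by blast
      qed
    qed
  qed
  moreover have "Z v (param c u) = from_chart A c (param c u) v" if "u \<in> ball u0 r" for u v
  proof -
    have "u \<in> img_of c" using that r by (auto simp: subset_iff)
    then show ?thesis
      using that chart by (simp add: Z_def param_in_dom coord_param f(2))
  qed
  moreover have "ball u0 r \<subseteq> img_of c" using r by (auto simp: subset_iff)
  ultimately show ?thesis
    using that[of "ball u0 r"] r(1) by (metis centre_in_ball open_ball)
qed

lemma vector_field_through:
  obtains Z where "vector_field A Z" "Z p = w"
proof -
  let ?c = "chart_at A p"
  have c: "?c \<in> A" "p \<in> dom_of ?c" by (rule chart_at)+
  then have u: "coord ?c p \<in> img_of ?c" by simp
  obtain W where W: "coord ?c p \<in> W" "\<And>v. \<exists>Z. vector_field A Z \<and>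
      (\<forall>u\<in>W. Z (param ?c u) = from_chart A ?c (param ?c u) v)"
    using coordinate_fields[OF c(1) u] by metis
  obtain Z where "vector_field A Z"
    "\<forall>u\<in>W. Z (param ?c u) = from_chart A ?c (param ?c u) (to_chart A ?c p w)"
    using W(2) by blast
  moreover have "param ?c (coord ?c p) = p"
    using c atlas_is_chart param_coord by blast
  ultimately show ?thesis
    using W(1) that from_chart_to_chart[OF c] by metis
qed

end

section \<open>The torsion of a natural connection\<close>

lemma trace_matrix_conjugate:
  fixes f g h :: "real ^ 'k::finite \<Rightarrow> real ^ 'k"
  assumes "linear f" "linear g" "linear h" "\<And>v. h (g v) = v"
  shows "trace (matrix (\<lambda>v. g (f (h v)))) = trace (matrix f)"
proof -
  have "matrix (\<lambda>v. g (f (h v))) = matrix g ** (matrix f ** matrix h)"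
    using matrix_compose[of "f \<circ> h" g] matrix_compose[of h f] assms(1-3)
    by (simp add: comp_def linear_compose[unfolded comp_def])
  moreover have "matrix h ** matrix g = mat 1"
    using matrix_compose[of g h] assms by (simp add: comp_def matrix_id_mat_1[unfolded id_def])
  ultimately show ?thesis
    by (metis matrix_mul_assoc matrix_mul_rid trace_mul_sym)
qed

text \<open>The trace of \<open>b f = a id\<close> gives \<open>a dim = 0\<close>, and then \<open>b f = 0\<close> for the invertible map
  \<open>f\<close>.\<close>

lemma involution_trace_0_independent:
  fixes f :: "real ^ 'k::finite \<Rightarrow> real ^ 'k"
  assumes "linear f" "\<And>v. f (f v) = v" "trace (matrix f) = 0"
    and eq: "\<And>v. b *\<^sub>R f v = a *\<^sub>R v"
  shows "a = 0" "b = 0"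
proof -
  have "b * f (axis i 1) $ i = a" for i
    using arg_cong[OF eq[of "axis i 1"], of "\<lambda>v. v $ i"] by simp
  then have "(\<Sum>i\<in>UNIV. b * f (axis i 1) $ i) = real CARD('k) * a" by simp
  moreover have "(\<Sum>i\<in>UNIV. b * f (axis i 1) $ i) = b * trace (matrix f)"
    by (simp add: trace_def matrix_def sum_distrib_left)
  ultimately show a: "a = 0" using assms(3) by simp
  show "b = 0"
  proof (rule ccontr)
    assume "b \<noteq> 0"
    then have "f v = 0" for v using eq[of v] a by simp
    then have "v = 0" for v :: "real ^ 'k" using assms(2)[of v] by simp
    from this[of "axis undefined 1"] show False by (simp add: axis_eq_0_iff)
  qed
qed

text \<open>At a single point, the torsion of the connection with parameters \<open>l\<close> and \<open>m\<close>, where \<open>m' =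
  m + 1 / (2 n)\<close> and \<open>J\<close> is the value of \<open>P\<close>.\<close>

definition torsion_tensor ::
  "('v \<Rightarrow> 'v) \<Rightarrow> ('v \<Rightarrow> real) \<Rightarrow> real \<Rightarrow> real \<Rightarrow> real \<Rightarrow> 'v \<Rightarrow> 'v \<Rightarrow> 'v::real_vector" where
  "torsion_tensor J \<theta> l m m' x y =
     (l * \<theta> (J x) + m * \<theta> x) *\<^sub>R J y - (l * \<theta> (J y) + m * \<theta> y) *\<^sub>R J x
   + (l * \<theta> x + m' * \<theta> (J x)) *\<^sub>R y - (l * \<theta> y + m' * \<theta> (J y)) *\<^sub>R x"

text \<open>In \<open>J T(x, y) - T(x, J y)\<close> everything cancels except the terms whose coefficients differ
  by \<open>m' - m\<close>. What remains recovers \<open>\<theta>\<close> from the torsion, whatever \<open>l\<close> and \<open>m\<close> are. The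
  identity is arranged without subtraction so that a connection can be applied to both sides
  with the sum and product rules alone; \<open>c\<close> will be the dimension \<open>2 n\<close>.\<close>

lemma torsion_tensor_commutator:
  assumes "linear J" "\<And>v. J (J v) = v" "c * (m' - m) = 1"
  shows "c *\<^sub>R J (torsion_tensor J \<theta> l m m' x y) + \<theta> (J y) *\<^sub>R J x =
    c *\<^sub>R torsion_tensor J \<theta> l m m' x (J y) + \<theta> y *\<^sub>R x"
proof -
  have "J (torsion_tensor J \<theta> l m m' x y) =
      torsion_tensor J \<theta> l m m' x (J y) + (m' - m) *\<^sub>R (\<theta> y *\<^sub>R x - \<theta> (J y) *\<^sub>R J x)"
    by (simp add: torsion_tensor_def linear_add linear_diff linear_cmul assms(1,2) algebra_simps)
  then have "c *\<^sub>R J (torsion_tensor J \<theta> l m m' x y) = c *\<^sub>R torsion_tensor J \<theta> l m m' x (J y) +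
      (c * (m' - m)) *\<^sub>R (\<theta> y *\<^sub>R x - \<theta> (J y) *\<^sub>R J x)"
    by (simp only: scaleR_add_right scaleR_scaleR)
  then show ?thesis
    by (simp only: assms(3)) simp
qed

lemma theta_J_torsion_tensor:
  assumes "linear \<theta>" "\<And>v. J (J v) = v"
    "linear J"
  shows "\<theta> (J (torsion_tensor J \<theta> l m m' x y)) = 0"
  by (simp add: torsion_tensor_def linear_add linear_diff linear_cmul assms algebra_simps)

lemma theta_torsion_tensor:
  assumes "linear \<theta>"
  shows "\<theta> (torsion_tensor J \<theta> l m m' x y) =
    (m' - m) * (\<theta> (J x) * \<theta> y - \<theta> x * \<theta> (J y))"
  by (simp add: torsion_tensor_def linear_add linear_diff linear_cmul assms algebra_simps)

lemma linear_theta: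
  assumes "riemannian_metric A g"
  shows "linear (theta A P g D p)"
proof -
  have "linear (g p v)" for v
    using assms by (simp add: riemannian_metric_def bilinear_def)
  then have "linear (\<lambda>x. c * g p v x)" for c v
    using linear_compose_scale_right[of "g p v" c] by simp
  then show ?thesis
    unfolding theta_def[abs_def] F_tensor_def by (intro linear_compose_sum ballI)
qed

text \<open>The terms of the connection that contain \<open>\<Omega>\<close> have the coefficients \<open>g(x, P y)\<close> and \<open>g(x,
  y)\<close>, which are symmetric in \<open>x\<close> and \<open>y\<close>, and so they drop out; the Levi-Civita part accounts
  for the bracket.\<close>

lemma torsion_nat_conn:
  assumes "riemannian_almost_product A n P g" "levi_civita A g D"
    and "vector_field A X" "vector_field A Y"
  shows "torsion A (nat_conn A n P g D l m) X Y p =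
    torsion_tensor (P p) (theta A P g D p) l m (m + 1 / (2 * real n)) (X p) (Y p)"
proof -
  have sym: "g p x y = g p y x" for x y
    using assms(1) by (simp add: riemannian_almost_product_def riemannian_metric_def)
  have PP: "P p (P p x) = x" and iso: "g p (P p x) (P p y) = g p x y" for x y
    using assms(1) by (simp_all add: riemannian_almost_product_def)
  have symP: "g p (Y p) (P p (X p)) = g p (X p) (P p (Y p))"
    using iso[of "Y p" "P p (X p)"] by (simp add: PP sym)
  have "lie_bracket A X Y p = D X Y p - D Y X p"
    using assms(2-4) by (simp add: levi_civita_def torsion_def)
  then show ?thesis
    by (simp add: torsion_def nat_conn_def torsion_tensor_def Let_def symP sym[of "Y p" "X p"]
        algebra_simps)
qed

lemma linear_connectionD:
  assumes "linear_connection A D" "vector_field A X" "vector_field A Y"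
  shows "vector_field A (D X Y)"
    and "vector_field A Z \<Longrightarrow> D X (\<lambda>p. Y p + Z p) = (\<lambda>p. D X Y p + D X Z p)"
    and "smooth_fun A f \<Longrightarrow>
      D X (\<lambda>p. f p *\<^sub>R Y p) = (\<lambda>p. dir_deriv A X f p *\<^sub>R Y p + f p *\<^sub>R D X Y p)"
  using assms by (simp_all add: linear_connection_def)

lemma dir_deriv_const: "dir_deriv A X (\<lambda>_. k) p = 0"
  by (simp add: dir_deriv_def comp_def)

text \<open>Subtracting the vanishing torsion of the Levi-Civita connection removes the bracket and
  leaves covariant derivatives, which are smooth by the definition of a linear connection.\<close>

lemma vector_field_torsion:
  assumes rap: "riemannian_almost_product A n P g" and lc: "levi_civita A g D"
    and conn: "linear_connection A D'"
    and X: "vector_field A X" and Y: "vector_field A Y"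
  shows "vector_field A (torsion A D' X Y)"
proof -
  have atlas: "smooth_atlas A" using rap by (simp add: riemannian_almost_product_def)
  have connD: "linear_connection A D" using lc by (simp add: levi_civita_def)
  have "torsion A D X Y p = 0" for p
    using lc X Y by (simp add: levi_civita_def)
  then have "torsion A D' X Y = (\<lambda>p. (D' X Y p - D' Y X p) - (D X Y p - D Y X p))"
    by (simp add: torsion_def fun_eq_iff algebra_simps)
  then show ?thesis
    using X Y connD conn by (simp add: vector_field_diff[OF atlas] linear_connectionD(1))
qed

section \<open>Smoothness and parallelism of theta\<close>

text \<open>By \<open>torsion_tensor_commutator\<close>, the endomorphism \<open>x \<mapsto> \<theta>(y) x - \<theta>(P y) P x\<close> is smooth when
  \<open>y\<close> is, since the torsion and \<open>P\<close> are. Its trace is \<open>2 n \<theta>(y)\<close> because \<open>tr P = 0\<close>; computing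
  the trace in a coordinate frame around a point shows that \<open>\<theta>(y)\<close> is smooth.\<close>

lemma one_form_theta:
  fixes A :: "('m::{t2_space, second_countable_topology}, 'k::finite) chart set"
  assumes rap: "riemannian_almost_product A n P g" and lc: "levi_civita A g D"
    and conn: "linear_connection A (nat_conn A n P g D l m)"
  shows "one_form A (theta A P g D)"
proof -
  let ?D = "nat_conn A n P g D l m" and ?\<theta> = "theta A P g D"
  let ?t = "\<lambda>p. torsion_tensor (P p) (?\<theta> p) l m (m + 1 / (2 * real n))"
  have atlas: "smooth_atlas A" and endo: "endomorphism_field A P"
    and metric: "riemannian_metric A g" and dim: "CARD('k) = 2 * n"
    and PP: "\<And>p x. P p (P p x) = x" and tr: "\<And>p. trace (matrix (P p)) = 0"
    using rap by (simp_all add: riemannian_almost_product_def)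
  have linP: "linear (P p)" for p using endo by (simp add: endomorphism_field_def)
  have lin\<theta>: "linear (?\<theta> p)" for p by (rule linear_theta[OF metric])
  have n: "n \<noteq> 0" using dim by (cases n) auto
  have vfT: "vector_field A (\<lambda>p. ?t p (X p) (Y p))"
    if X: "vector_field A X" and Y: "vector_field A Y" for X Y
    using vector_field_torsion[OF rap lc conn X Y]
    unfolding torsion_nat_conn[OF rap lc X Y, abs_def] .
  have main: "smooth_on (img_of c) (\<lambda>u. ?\<theta> (param c u) (from_chart A c (param c u) v))"
    if c: "c \<in> A" for c v
  proof (rule smooth_on_local)
    have chart: "is_chart c" using c by (rule atlas_is_chart[OF atlas])
    show "open (img_of c)" using chart by (rule open_img_of)
    fix u0 assume "u0 \<in> img_of c"
    then obtain W where W: "open W" "u0 \<in> W" "W \<subseteq> img_of c"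
      and ext: "\<And>w. \<exists>Z. vector_field A Z \<and>
        (\<forall>u\<in>W. Z (param c u) = from_chart A c (param c u) w)"
      using coordinate_fields[OF atlas c] by metis
    obtain Z where Z: "\<And>w. vector_field A (Z w)"
      "\<And>w u. u \<in> W \<Longrightarrow> Z w (param c u) = from_chart A c (param c u) w"
      using ext by metis
    \<comment> \<open>the endomorphism \<open>x \<mapsto> \<theta>(y) x - \<theta>(P y) P x\<close> at the \<open>i\<close>-th frame field, expressed by the torsion\<close>
    define U where "U i p = (2 * real n) *\<^sub>R P p (?t p (Z (axis i 1) p) (Z v p)) -
      (2 * real n) *\<^sub>R ?t p (Z (axis i 1) p) (P p (Z v p))" for i p
    have "vector_field A (U i)" for i
      unfolding U_def
      by (intro vector_field_diff[OF atlas] vector_field_scale[OF atlas smooth_fun_const[OF atlas]]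
          vector_field_endo[OF atlas endo] vfT Z)
    then have "smooth_on W (field_rep A c (U i))" for i
      using c W(3) smooth_on_subset by (metis vector_field_def)
    then have "smooth_on W (\<lambda>u. field_rep A c (U i) u $ i)" for i
      by (rule smooth_on_linear[OF W(1) bounded_linear_vec_nth])
    then have "smooth_on W (\<lambda>u. \<Sum>i\<in>UNIV. field_rep A c (U i) u $ i)"
      by (intro smooth_on_sum[OF W(1)])
    then have "smooth_on W (\<lambda>u. (\<Sum>i\<in>UNIV. field_rep A c (U i) u $ i) / real CARD('k))"
      by (rule smooth_on_linear[OF W(1) bounded_linear_divide])
    then have "smooth_on W (\<lambda>u. ?\<theta> (param c u) (from_chart A c (param c u) v))"
    proof (rule smooth_on_cong[OF W(1), rotated])
      fix u assume u: "u \<in> W"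
      let ?p = "param c u"
      let ?to = "to_chart A c ?p" and ?from = "from_chart A c ?p"
      have p: "?p \<in> dom_of c" using u W(3) chart param_in_dom by blast
      have linto: "linear ?to" by (rule linear_to_chart[OF atlas c p])
      have linfrom: "linear ?from" by (rule linear_from_chart[OF atlas c p])
      have to_from: "?to (?from w) = w" for w
        by (simp add: to_chart_from_chart[OF atlas] coord_change_self[OF atlas] c p)
      have "U i ?p = ?\<theta> ?p (?from v) *\<^sub>R ?from (axis i 1) -
          ?\<theta> ?p (P ?p (?from v)) *\<^sub>R P ?p (?from (axis i 1))" for i
        using torsion_tensor_commutator[OF linP[of ?p] PP, where c = "2 * real n" and m = m
            and m' = "m + 1 / (2 * real n)" and \<theta> = "?\<theta> ?p" and l = l
            and x = "?from (axis i 1)" and y = "?from v"] n u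
        by (simp add: U_def Z(2) algebra_simps)
      then have "field_rep A c (U i) u = ?\<theta> ?p (?from v) *\<^sub>R axis i 1 -
          ?\<theta> ?p (P ?p (?from v)) *\<^sub>R ?to (P ?p (?from (axis i 1)))" for i
        by (simp add: field_rep_apply[OF atlas] linear_diff[OF linto] linear_cmul[OF linto] to_from)
      then have "(\<Sum>i\<in>UNIV. field_rep A c (U i) u $ i) = real CARD('k) * ?\<theta> ?p (?from v) -
          ?\<theta> ?p (P ?p (?from v)) * trace (matrix (\<lambda>w. ?to (P ?p (?from w))))"
        by (simp add: sum_subtractf trace_def matrix_def sum_distrib_left)
      also have "trace (matrix (\<lambda>w. ?to (P ?p (?from w)))) = 0"
        using trace_matrix_conjugate[OF linP linto linfrom] from_chart_to_chart[OF atlas c p] tr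
        by simp
      finally show "(\<Sum>i\<in>UNIV. field_rep A c (U i) u $ i) / real CARD('k) = ?\<theta> ?p (?from v)"
        by simp
    qed
    then show "\<exists>T. open T \<and> u0 \<in> T \<and>
        smooth_on T (\<lambda>u. ?\<theta> (param c u) (from_chart A c (param c u) v))"
      using W by blast
  qed
  show ?thesis
    using main lin\<theta> by (simp add: one_form_def Let_def)
qed

text \<open>Covariant differentiation of the identity \<open>torsion_tensor_commutator\<close> along \<open>X\<close>, with
  parallel torsion and \<open>P\<close>, gives \<open>(\<nabla>'\<^sub>X(\<theta> \<circ> P))(y) P z = (\<nabla>'\<^sub>X\<theta>)(y) z\<close> for all \<open>z\<close>, and since
  \<open>P\<close> has trace \<open>0\<close>, both coefficients vanish.\<close>

lemma parallel_theta:
  fixes A :: "('m::{t2_space, second_countable_topology}, 'k::finite) chart set"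
    and n :: nat
    and P :: "'m \<Rightarrow> real ^ 'k \<Rightarrow> real ^ 'k"
    and g :: "'m \<Rightarrow> real ^ 'k \<Rightarrow> real ^ 'k \<Rightarrow> real"
    and D :: "('m, 'k) connection"
    and l m :: real
  defines "D' \<equiv> nat_conn A n P g D l m" and "\<theta> \<equiv> theta A P g D"
  assumes rap: "riemannian_almost_product A n P g" and lc: "levi_civita A g D"
    and nat: "natural_connection A P g D'"
    and par: "parallel_torsion A D'"
    and X: "vector_field A X" and Y: "vector_field A Y"
  shows "dir_deriv A X (\<lambda>q. \<theta> q (Y q)) p = \<theta> p (D' X Y p)"
    and "dir_deriv A X (\<lambda>q. \<theta> q (P q (Y q))) p = \<theta> p (P p (D' X Y p))"
proof -
  let ?t = "\<lambda>p. torsion_tensor (P p) (\<theta> p) l m (m + 1 / (2 * real n))"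
  let ?c = "2 * real n"
  have atlas: "smooth_atlas A" and endo: "endomorphism_field A P"
    and dim: "CARD('k) = 2 * n"
    and PP: "\<And>p x. P p (P p x) = x" and tr: "\<And>p. trace (matrix (P p)) = 0"
    using rap by (simp_all add: riemannian_almost_product_def)
  have linP: "linear (P p)" for p using endo by (simp add: endomorphism_field_def)
  have n: "n \<noteq> 0" using dim by (cases n) auto
  have conn: "linear_connection A D'" using nat by (simp add: natural_connection_def)
  note vfD = linear_connectionD(1)[OF conn] and Dadd = linear_connectionD(2)[OF conn]
    and Dfun = linear_connectionD(3)[OF conn]
  have vfP: "vector_field A (\<lambda>q. P q (V q))" if "vector_field A V" for V
    using that by (rule vector_field_endo[OF atlas endo])
  have DP: "D' V (\<lambda>q. P q (W q)) = (\<lambda>q. P q (D' V W q))"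
    if "vector_field A V" "vector_field A W" for V W
    using nat that by (auto simp: natural_connection_def cov_deriv_endo_def)
  have tors: "torsion A D' V W = (\<lambda>q. ?t q (V q) (W q))"
    if "vector_field A V" "vector_field A W" for V W
    using torsion_nat_conn[OF rap lc that] by (auto simp: D'_def \<theta>_def)
  have Dt: "D' X (\<lambda>q. ?t q (V q) (W q)) p = ?t p (D' X V p) (W p) + ?t p (V p) (D' X W p)"
    if V: "vector_field A V" and W: "vector_field A W" for V W
  proof -
    have "D' X (torsion A D' V W) p - torsion A D' (D' X V) W p - torsion A D' V (D' X W) p = 0"
      using par X V W by (simp add: parallel_torsion_def)
    then show ?thesis
      by (simp add: tors V W vfD[OF X V] vfD[OF X W] algebra_simps)
  qed
  have vft: "vector_field A (\<lambda>q. ?t q (V q) (W q))"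
    if V: "vector_field A V" and W: "vector_field A W" for V W
    using vector_field_torsion[OF rap lc conn V W] by (simp only: tors[OF V W])
  have one: "one_form A \<theta>"
    using one_form_theta[OF rap lc conn[unfolded D'_def]] by (simp add: \<theta>_def)
  have f1: "smooth_fun A (\<lambda>q. \<theta> q (Y q))"
    by (rule smooth_fun_one_form[OF atlas one Y])
  have f2: "smooth_fun A (\<lambda>q. \<theta> q (P q (Y q)))"
    by (rule smooth_fun_one_form[OF atlas one vfP[OF Y]])
  have key: "?c *\<^sub>R P q (?t q x y) + \<theta> q (P q y) *\<^sub>R P q x = ?c *\<^sub>R ?t q x (P q y) + \<theta> q y *\<^sub>R x"
    for q x y
    by (rule torsion_tensor_commutator[OF linP PP]) (use n in simp)
  let ?a = "dir_deriv A X (\<lambda>q. \<theta> q (Y q)) p - \<theta> p (D' X Y p)"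
  let ?b = "dir_deriv A X (\<lambda>q. \<theta> q (P q (Y q))) p - \<theta> p (P p (D' X Y p))"
  have "?b *\<^sub>R P p z = ?a *\<^sub>R z" for z
  proof -
    obtain Z where Z: "vector_field A Z" "Z p = z"
      by (rule vector_field_through[OF atlas])
    \<comment> \<open>the two sides of \<open>key\<close> for \<open>Z\<close> and \<open>Y\<close>, differentiated along \<open>X\<close>\<close>
    let ?dZ = "D' X Z p" and ?dY = "D' X Y p"
    have "D' X (\<lambda>q. ?c *\<^sub>R P q (?t q (Z q) (Y q)) + \<theta> q (P q (Y q)) *\<^sub>R P q (Z q)) p =
        ?c *\<^sub>R P p (?t p ?dZ (Y p) + ?t p z ?dY) +
        (dir_deriv A X (\<lambda>q. \<theta> q (P q (Y q))) p *\<^sub>R P p z + \<theta> p (P p (Y p)) *\<^sub>R P p ?dZ)"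
      using X Y Z vft vfP f2
      by (simp add: Dadd Dfun dir_deriv_const DP Dt vector_field_scale[OF atlas]
          smooth_fun_const[OF atlas])
    moreover have "D' X (\<lambda>q. ?c *\<^sub>R ?t q (Z q) (P q (Y q)) + \<theta> q (Y q) *\<^sub>R Z q) p =
        ?c *\<^sub>R (?t p ?dZ (P p (Y p)) + ?t p z (P p ?dY)) +
        (dir_deriv A X (\<lambda>q. \<theta> q (Y q)) p *\<^sub>R z + \<theta> p (Y p) *\<^sub>R ?dZ)"
      using X Y Z vft vfP f1
      by (simp add: Dadd Dfun dir_deriv_const DP Dt vector_field_scale[OF atlas]
          smooth_fun_const[OF atlas])
    ultimately have sum: "?c *\<^sub>R P p (?t p ?dZ (Y p)) + ?c *\<^sub>R P p (?t p z ?dY) +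
        (dir_deriv A X (\<lambda>q. \<theta> q (P q (Y q))) p *\<^sub>R P p z + \<theta> p (P p (Y p)) *\<^sub>R P p ?dZ) =
        ?c *\<^sub>R ?t p ?dZ (P p (Y p)) + ?c *\<^sub>R ?t p z (P p ?dY) +
        (dir_deriv A X (\<lambda>q. \<theta> q (Y q)) p *\<^sub>R z + \<theta> p (Y p) *\<^sub>R ?dZ)"
      unfolding key by (simp add: linear_add[OF linP] scaleR_add_right)
    \<comment> \<open>subtract \<open>key\<close> for the pairs \<open>\<nabla>'\<^sub>X Z\<close>, \<open>Y\<close> and \<open>Z\<close>, \<open>\<nabla>'\<^sub>X Y\<close>\<close>
    have dZ: "?c *\<^sub>R P p (?t p ?dZ (Y p)) =
        ?c *\<^sub>R ?t p ?dZ (P p (Y p)) + \<theta> p (Y p) *\<^sub>R ?dZ - \<theta> p (P p (Y p)) *\<^sub>R P p ?dZ"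
      using key[of p ?dZ "Y p"] by (simp add: eq_diff_eq)
    have dY: "?c *\<^sub>R P p (?t p z ?dY) =
        ?c *\<^sub>R ?t p z (P p ?dY) + \<theta> p ?dY *\<^sub>R z - \<theta> p (P p ?dY) *\<^sub>R P p z"
      using key[of p z ?dY] by (simp add: eq_diff_eq)
    show ?thesis
      using sum unfolding dZ dY by (simp add: algebra_simps)
  qed
  then have "?a = 0" "?b = 0"
    using involution_trace_0_independent[OF linP PP tr] by blast+
  then show "dir_deriv A X (\<lambda>q. \<theta> q (Y q)) p = \<theta> p (D' X Y p)"
    and "dir_deriv A X (\<lambda>q. \<theta> q (P q (Y q))) p = \<theta> p (P p (D' X Y p))"
    by simp_all
qed

section \<open>Closed one-forms\<close>

text \<open>For a parallel form, \<open>X (\<alpha> Y) = \<alpha> (\<nabla>'\<^sub>X Y)\<close>, so the exterior derivative \<open>d\<alpha>(X, Y)\<close>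
  collapses to \<open>\<alpha>(T(X, Y))\<close>.\<close>

lemma closed_parallel_one_form:
  assumes "one_form A \<alpha>"
    and parallel: "\<And>X Y p. vector_field A X \<Longrightarrow> vector_field A Y \<Longrightarrow>
      dir_deriv A X (\<lambda>q. \<alpha> q (Y q)) p = \<alpha> p (D X Y p)"
    and torsion: "\<And>X Y p. vector_field A X \<Longrightarrow> vector_field A Y \<Longrightarrow>
      \<alpha> p (torsion A D X Y p) = 0"
  shows "closed_one_form A \<alpha>"
proof -
  have lin: "linear (\<alpha> p)" for p using assms(1) by (simp add: one_form_def)
  have "ext_deriv A \<alpha> X Y p = \<alpha> p (torsion A D X Y p)"
    if "vector_field A X" "vector_field A Y" for X Y p
    by (simp add: ext_deriv_def torsion_def parallel that linear_diff[OF lin])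
  then show ?thesis
    using assms(1) torsion by (simp add: closed_one_form_def)
qed

theorem corollary5p2:
  fixes A :: "('m::{t2_space, second_countable_topology}, 'k::finite) chart set"
    and n :: nat
    and P :: "'m \<Rightarrow> real ^ 'k \<Rightarrow> real ^ 'k"
    and g :: "'m \<Rightarrow> real ^ 'k \<Rightarrow> real ^ 'k \<Rightarrow> real"
    and D :: "('m, 'k) connection"
  assumes "riemannian_almost_product A n P g"
    and "levi_civita A g D"
    and "W1 A n P g D"
    and "\<exists>l m. natural_connection A P g (nat_conn A n P g D l m) \<and>
               parallel_torsion A (nat_conn A n P g D l m)"
  shows "closed_one_form A (\<lambda>p x. theta A P g D p (P p x)) \<and>
         (W3_bar A n P g D \<or> W6_bar A n P g D \<longrightarrow> closed_one_form A (theta A P g D))"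
proof -
  obtain l m where nat: "natural_connection A P g (nat_conn A n P g D l m)"
    and par: "parallel_torsion A (nat_conn A n P g D l m)"
    using assms(4) by blast
  let ?\<theta> = "theta A P g D"
  have atlas: "smooth_atlas A" and endo: "endomorphism_field A P"
    and metric: "riemannian_metric A g" and PP: "\<And>p x. P p (P p x) = x"
    using assms(1) by (simp_all add: riemannian_almost_product_def)
  have linP: "linear (P p)" for p using endo by (simp add: endomorphism_field_def)
  have lin\<theta>: "linear (?\<theta> p)" for p by (rule linear_theta[OF metric])
  have one: "one_form A ?\<theta>"
    using nat by (intro one_form_theta[OF assms(1,2), of l m]) (simp add: natural_connection_def)
  note parallel = parallel_theta[OF assms(1,2) nat par]
  note tors = torsion_nat_conn[OF assms(1,2)]
  have "closed_one_form A (\<lambda>p x. ?\<theta> p (P p x))"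
  proof (rule closed_parallel_one_form[where D = "nat_conn A n P g D l m"])
    show "one_form A (\<lambda>p x. ?\<theta> p (P p x))"
      by (rule one_form_comp_endo[OF atlas one endo])
    show "?\<theta> p (P p (torsion A (nat_conn A n P g D l m) X Y p)) = 0"
      if "vector_field A X" "vector_field A Y" for X Y p
      unfolding tors[OF that] by (rule theta_J_torsion_tensor[OF lin\<theta> PP linP])
  qed (rule parallel(2))
  moreover have "closed_one_form A ?\<theta>" if "W3_bar A n P g D \<or> W6_bar A n P g D"
  proof (rule closed_parallel_one_form[where D = "nat_conn A n P g D l m"])
    have "(\<forall>p x. ?\<theta> p (P p x) = - ?\<theta> p x) \<or> (\<forall>p x. ?\<theta> p (P p x) = ?\<theta> p x)"
      using that unfolding W3_bar_def W6_bar_def Let_def by blast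
    then have "?\<theta> p (P p x) * ?\<theta> p y = ?\<theta> p x * ?\<theta> p (P p y)" for p x y
      by auto
    then show "?\<theta> p (torsion A (nat_conn A n P g D l m) X Y p) = 0"
      if "vector_field A X" "vector_field A Y" for X Y p
      unfolding tors[OF that] theta_torsion_tensor[OF lin\<theta>] by simp
  qed (rule one parallel(1))+
  ultimately show ?thesis by blast
qed

end
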